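(* Let $\mathfrak M=(E,\mathcal I)$ be a matroid of rank $r$, let $p\in\{1,\dots,r\}$ and $q\in\{0,\dots,r-1\}$, and let $(I,J)$ and $(I',J')$ be two non-isolated vertices of $\mathcal G_{p,q}$. Then $(I,J)$ and $(I',J')$ lie in the same connected component of $\mathcal G_{p,q}$ if and only if $I\uplus J=I'\uplus J'$ and $\mathrm{MCP}(I,J)=\mathrm{MCP}(I',J')$.
   Context: $\mathcal I_l$ is the set of independent sets of size $l$; $\mathrm{cl}(A):=\{i\in E:\mathrm{rk}(A\cup\{i\})=\mathrm{rk}(A)\}$ is the matroid closure. The exchange graph $\mathcal G$ of $\mathfrak M$ has vertex set $\mathcal I\times\mathcal I$, and $(I_1,I_2)$, $(I_1',I_2')$ are adjacent if there is $i\in E$ with either $I_1'=I_1\cup\{i\}$, $i\notin I_1$, $I_2'=I_2\setminus\{i\}$, $i\in I_2$, or the same with the roles reversed ($I_1'=I_1\setminus\{i\}$, $I_2'=I_2\cup\{i\}$). $\mathcal G_{p,q}$ is the induced subgraph of $\mathcal G$ on $(\mathcal I_p\times\mathcal I_q)\sqcup(\mathcal I_{p-1}\times\mathcal I_{q+1})$. $I\uplus J$ is the multiset union (elements of $I\cap J$ counted twice). For $(I,J)\in\mathcal I\times\mathcal I$, a codependent pair of $(I,J)$ is a pair $(U,V)$ with $U\subset I$, $V\subset J$ and $\mathrm{cl}(U)=\mathrm{cl}(V)$; the componentwise union of two codependent pairs is codependent, and $\mathrm{MCP}(I,J)$ is the unique inclusion-maximal codependent pair of $(I,J)$. *)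

theory Defs
  imports "HOL-Library.Multiset" "Graph_Theory.Graph_Theory"
begin

locale matroid =
  fixes E :: "'a set" and \<I> :: "'a set set"
  assumes finite_ground: "finite E"
    and indep_subset_ground: "X \<in> \<I> \<Longrightarrow> X \<subseteq> E"
    and indep_empty: "{} \<in> \<I>"
    and indep_mono: "Y \<in> \<I> \<Longrightarrow> X \<subseteq> Y \<Longrightarrow> X \<in> \<I>"
    and augment: "X \<in> \<I> \<Longrightarrow> Y \<in> \<I> \<Longrightarrow> card X < card Y \<Longrightarrow> \<exists>x \<in> Y - X. insert x X \<in> \<I>"

definition rk :: "'a set set \<Rightarrow> 'a set \<Rightarrow> nat" where
  "rk \<I> A = Max {card X | X. X \<in> \<I> \<and> X \<subseteq> A}"

definition cl :: "'a set \<Rightarrow> 'a set set \<Rightarrow> 'a set \<Rightarrow> 'a set" where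
  "cl E \<I> A = {i \<in> E. rk \<I> (A \<union> {i}) = rk \<I> A}"

definition indep_of_size :: "'a set set \<Rightarrow> nat \<Rightarrow> 'a set set" where
  "indep_of_size \<I> l = {X \<in> \<I>. card X = l}"

definition codependent :: "'a set \<Rightarrow> 'a set set \<Rightarrow> 'a set \<times> 'a set \<Rightarrow> 'a set \<times> 'a set \<Rightarrow> bool" where
  "codependent E \<I> = (\<lambda>(I, J) (U, V). U \<subseteq> I \<and> V \<subseteq> J \<and> cl E \<I> U = cl E \<I> V)"

definition pair_subset :: "'a set \<times> 'a set \<Rightarrow> 'a set \<times> 'a set \<Rightarrow> bool" where
  "pair_subset = (\<lambda>(U, V) (U', V'). U \<subseteq> U' \<and> V \<subseteq> V')"

definition maximal_codependent ::
    "'a set \<Rightarrow> 'a set set \<Rightarrow> 'a set \<times> 'a set \<Rightarrow> 'a set \<times> 'a set \<Rightarrow> bool" where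
  "maximal_codependent E \<I> P Q \<longleftrightarrow> codependent E \<I> P Q \<and>
     (\<forall>Q'. codependent E \<I> P Q' \<and> pair_subset Q Q' \<longrightarrow> Q' = Q)"

text \<open>For a pair of independent sets of a matroid the description is proper; see
  \<open>ex1_maximal_codependent\<close> below.\<close>

definition MCP :: "'a set \<Rightarrow> 'a set set \<Rightarrow> 'a set \<times> 'a set \<Rightarrow> 'a set \<times> 'a set" where
  "MCP E \<I> P = (THE Q. maximal_codependent E \<I> P Q)"

definition exchange_adjacent ::
    "'a set \<Rightarrow> 'a set \<times> 'a set \<Rightarrow> 'a set \<times> 'a set \<Rightarrow> bool" where
  "exchange_adjacent E = (\<lambda>(I1, I2) (I1', I2'). \<exists>i \<in> E.
      (i \<notin> I1 \<and> I1' = I1 \<union> {i} \<and> i \<in> I2 \<and> I2' = I2 - {i}) \<or>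
      (i \<in> I1 \<and> I1' = I1 - {i} \<and> i \<notin> I2 \<and> I2' = I2 \<union> {i}))"

text \<open>Undirected graphs are symmetric digraphs here: each edge is represented by both of its
  orientations.\<close>

definition exchange_graph :: "'a set \<Rightarrow> 'a set set \<Rightarrow> ('a set \<times> 'a set) pair_pre_digraph" where
  "exchange_graph E \<I> = \<lparr> pverts = \<I> \<times> \<I>,
     parcs = {(x, y). x \<in> \<I> \<times> \<I> \<and> y \<in> \<I> \<times> \<I> \<and> exchange_adjacent E x y} \<rparr>"

text \<open>Meaningful for \<open>p \<ge> 1\<close> only: the subtraction is truncated.\<close>

definition exchange_subgraph :: "'a set \<Rightarrow> 'a set set \<Rightarrow> nat \<Rightarrow> nat \<Rightarrow>
    ('a set \<times> 'a set, ('a set \<times> 'a set) \<times> ('a set \<times> 'a set)) pre_digraph" where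
  "exchange_subgraph E \<I> p q = with_proj (exchange_graph E \<I>) \<restriction>
     (indep_of_size \<I> p \<times> indep_of_size \<I> q \<union>
      indep_of_size \<I> (p - 1) \<times> indep_of_size \<I> (q + 1))"

definition isolated_vertex :: "('v, 'e) pre_digraph \<Rightarrow> 'v \<Rightarrow> bool" where
  "isolated_vertex G v \<longleftrightarrow> v \<in> verts G \<and> \<not> (\<exists>w. v \<rightarrow>\<^bsub>G\<^esub> w)"

text \<open>In a symmetric digraph the strongly connected components are the connected components of
  the underlying undirected graph.\<close>

definition same_component :: "('v, 'e) pre_digraph \<Rightarrow> 'v \<Rightarrow> 'v \<Rightarrow> bool" where
  "same_component G v w \<longleftrightarrow> (\<exists>C \<in> pre_digraph.sccs_verts G. v \<in> C \<and> w \<in> C)"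

lemma exchange_adjacent_sym: "exchange_adjacent E x y \<Longrightarrow> exchange_adjacent E y x"
  unfolding exchange_adjacent_def by (force split: prod.splits)

lemma exchange_adjacent_irrefl: "\<not> exchange_adjacent E x x"
  unfolding exchange_adjacent_def by auto

context matroid
begin

lemma finite_indep: "X \<in> \<I> \<Longrightarrow> finite X"
  using finite_ground indep_subset_ground finite_subset by blast

lemma finite_family: "finite \<I>"
  using finite_ground indep_subset_ground by (auto intro: finite_subset[of _ "Pow E"])

lemma finite_rk_set: "finite {card X | X. X \<in> \<I> \<and> X \<subseteq> A}"
  using finite_family by auto

lemma card_le_rk: "X \<in> \<I> \<Longrightarrow> X \<subseteq> A \<Longrightarrow> card X \<le> rk \<I> A"
  unfolding rk_def by (rule Max_ge[OF finite_rk_set]) auto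

lemma rk_witness: "\<exists>X \<in> \<I>. X \<subseteq> A \<and> card X = rk \<I> A"
proof -
  have "{card X | X. X \<in> \<I> \<and> X \<subseteq> A} \<noteq> {}"
    using indep_empty by auto
  from Max_in[OF finite_rk_set this] show ?thesis
    unfolding rk_def by auto
qed

lemma rk_mono: "A \<subseteq> B \<Longrightarrow> rk \<I> A \<le> rk \<I> B"
  by (metis rk_witness card_le_rk subset_trans)

lemma extend_basis:
  assumes "X \<in> \<I>" "X \<subseteq> A"
  shows "\<exists>B \<in> \<I>. X \<subseteq> B \<and> B \<subseteq> A \<and> card B = rk \<I> A"
  using assms
proof (induction "rk \<I> A - card X" arbitrary: X)
  case 0
  then show ?case using card_le_rk by (metis diff_is_0_eq le_antisym subset_refl)
next
  case (Suc n)
  obtain Y where Y: "Y \<in> \<I>" "Y \<subseteq> A" "card Y = rk \<I> A" using rk_witness by blast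
  with Suc.hyps(2) have "card X < card Y" by linarith
  then obtain x where x: "x \<in> Y - X" "insert x X \<in> \<I>" using augment Suc.prems Y by blast
  have "card (insert x X) = Suc (card X)" using x finite_indep Suc.prems by auto
  then have "n = rk \<I> A - card (insert x X)" using Suc.hyps(2) by linarith
  from Suc.hyps(1)[OF this x(2)] x Y Suc.prems show ?case by auto
qed

lemma augment_in:
  assumes "X \<in> \<I>" "card X < rk \<I> A"
  shows "\<exists>x \<in> A - X. insert x X \<in> \<I>"
  using rk_witness[of A] augment assms by fastforce

lemma cl_subset_ground: "cl E \<I> A \<subseteq> E"
  by (auto simp: cl_def)

lemma cl_extensive: "A \<subseteq> E \<Longrightarrow> A \<subseteq> cl E \<I> A"
  by (auto simp: cl_def insert_absorb)

lemma cl_mono: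
  assumes "A \<subseteq> B"
  shows "cl E \<I> A \<subseteq> cl E \<I> B"
proof
  fix i assume i: "i \<in> cl E \<I> A"
  show "i \<in> cl E \<I> B"
  proof (rule ccontr)
    assume "i \<notin> cl E \<I> B"
    with i have "rk \<I> (insert i B) \<noteq> rk \<I> B" by (auto simp: cl_def)
    with rk_mono[OF subset_insertI[of B i]] have less: "rk \<I> B < rk \<I> (insert i B)" by auto
    obtain X where X: "X \<in> \<I>" "X \<subseteq> A" "card X = rk \<I> A" using rk_witness by blast
    obtain Y where Y: "Y \<in> \<I>" "X \<subseteq> Y" "Y \<subseteq> B" "card Y = rk \<I> B"
      using extend_basis[OF X(1)] X(2) assms by blast
    obtain x where x: "x \<in> insert i B - Y" "insert x Y \<in> \<I>"
      using augment_in[OF Y(1)] less Y(4) by metis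
    have "x \<notin> B"
    proof
      assume "x \<in> B"
      then have "card (insert x Y) \<le> rk \<I> B" using card_le_rk x Y by blast
      then show False using x Y finite_indep by auto
    qed
    then have "x = i" using x by blast
    then have "insert i X \<in> \<I>" using indep_mono[OF x(2)] Y by blast
    then have "card (insert i X) \<le> rk \<I> (insert i A)" using card_le_rk X by blast
    moreover have "i \<notin> X" using \<open>x = i\<close> x Y by blast
    ultimately have "Suc (rk \<I> A) \<le> rk \<I> (insert i A)" using X finite_indep by auto
    with i show False by (auto simp: cl_def)
  qed
qed

lemma rk_cl:
  assumes "A \<subseteq> E"
  shows "rk \<I> (cl E \<I> A) = rk \<I> A"
proof (rule ccontr)
  assume "rk \<I> (cl E \<I> A) \<noteq> rk \<I> A"
  with rk_mono[OF cl_extensive[OF assms]] have less: "rk \<I> A < rk \<I> (cl E \<I> A)" by auto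
  obtain X where X: "X \<in> \<I>" "X \<subseteq> A" "card X = rk \<I> A" using rk_witness by blast
  obtain x where x: "x \<in> cl E \<I> A - X" "insert x X \<in> \<I>"
    using augment_in[OF X(1)] less X(3) by metis
  have "card (insert x X) \<le> rk \<I> (insert x A)" using card_le_rk[OF x(2)] X by blast
  then show False using x X finite_indep by (auto simp: cl_def)
qed

lemma cl_least:
  assumes "A \<subseteq> E" "D \<subseteq> cl E \<I> A"
  shows "cl E \<I> D \<subseteq> cl E \<I> A"
proof
  fix i assume i: "i \<in> cl E \<I> D"
  then have "i \<in> cl E \<I> (cl E \<I> A)" using cl_mono[OF assms(2)] by blast
  then have "rk \<I> (insert i (cl E \<I> A)) = rk \<I> A" using rk_cl[OF assms(1)] by (auto simp: cl_def)
  moreover have "rk \<I> (insert i A) \<le> rk \<I> (insert i (cl E \<I> A))"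
    using cl_extensive[OF assms(1)] by (intro rk_mono) blast
  moreover have "rk \<I> A \<le> rk \<I> (insert i A)" by (intro rk_mono) blast
  ultimately show "i \<in> cl E \<I> A" using i by (auto simp: cl_def)
qed

lemma cl_Un_subset:
  assumes "U \<union> U' \<subseteq> E" "V \<union> V' \<subseteq> E" "cl E \<I> U = cl E \<I> V" "cl E \<I> U' = cl E \<I> V'"
  shows "cl E \<I> (U \<union> U') \<subseteq> cl E \<I> (V \<union> V')"
proof (rule cl_least[OF assms(2)])
  have "U \<subseteq> cl E \<I> V" "U' \<subseteq> cl E \<I> V'" using cl_extensive assms by auto
  then show "U \<union> U' \<subseteq> cl E \<I> (V \<union> V')"
    using cl_mono[of V "V \<union> V'"] cl_mono[of V' "V \<union> V'"] by blast
qed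

lemma codependent_union:
  assumes "I \<subseteq> E" "J \<subseteq> E" "codependent E \<I> (I, J) (U, V)" "codependent E \<I> (I, J) (U', V')"
  shows "codependent E \<I> (I, J) (U \<union> U', V \<union> V')"
proof -
  have "cl E \<I> (U \<union> U') = cl E \<I> (V \<union> V')"
    using assms unfolding codependent_def
    by (intro equalityI cl_Un_subset) auto
  then show ?thesis using assms by (auto simp: codependent_def)
qed

lemma ex1_maximal_codependent:
  assumes "I \<in> \<I>" "J \<in> \<I>"
  shows "\<exists>!Q. maximal_codependent E \<I> (I, J) Q"
proof -
  have sub: "I \<subseteq> E" "J \<subseteq> E" using assms indep_subset_ground by auto
  let ?C = "{Q. codependent E \<I> (I, J) Q}"
  have "?C \<subseteq> Pow I \<times> Pow J" by (auto simp: codependent_def)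
  then have fin: "finite ?C"
    using assms finite_indep by (meson finite_Pow_iff finite_SigmaI finite_subset)
  define f where "f Q = card (fst Q) + card (snd Q)" for Q :: "'a set \<times> 'a set"
  have "({}, {}) \<in> ?C" by (auto simp: codependent_def)
  then have ne: "f ` ?C \<noteq> {}" by blast
  obtain Q where Q: "Q \<in> ?C" "f Q = Max (f ` ?C)"
    using Max_in[OF finite_imageI[OF fin] ne] by (metis imageE)
  have max: "f Q' \<le> f Q" if "Q' \<in> ?C" for Q'
    using Q that fin by simp
  have greatest: "pair_subset Q' Q" if "codependent E \<I> (I, J) Q'" for Q'
  proof -
    obtain U V U' V' where eq: "Q = (U, V)" "Q' = (U', V')" by fastforce
    have "codependent E \<I> (I, J) (U \<union> U', V \<union> V')"
      using codependent_union[OF sub] Q that eq by auto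
    then have le: "card (U \<union> U') + card (V \<union> V') \<le> card U + card V"
      and fin': "finite (U \<union> U')" "finite (V \<union> V')"
      using max[of "(U \<union> U', V \<union> V')"] eq assms finite_indep
      by (auto simp: f_def codependent_def intro: finite_subset)
    have "card U \<le> card (U \<union> U')" "card V \<le> card (V \<union> V')"
      using fin' by (auto intro!: card_mono)
    with le have "card (U \<union> U') \<le> card U" "card (V \<union> V') \<le> card V" by linarith+
    then have "U = U \<union> U'" "V = V \<union> V'"
      using card_seteq[OF fin'(1) Un_upper1] card_seteq[OF fin'(2) Un_upper1] by auto
    then show ?thesis using eq by (auto simp: pair_subset_def)
  qed
  have anti: "Q' = Q''" if "pair_subset Q' Q''" "pair_subset Q'' Q'"
    for Q' Q'' :: "'a set \<times> 'a set"
    using that by (auto simp: pair_subset_def split: prod.splits)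
  show ?thesis
  proof (rule ex1I)
    show "maximal_codependent E \<I> (I, J) Q"
      using Q greatest anti by (auto simp: maximal_codependent_def)
  next
    fix Q' assume "maximal_codependent E \<I> (I, J) Q'"
    then show "Q' = Q" using Q(1) greatest[of Q'] unfolding maximal_codependent_def by blast
  qed
qed

lemma graph_exchange_subgraph: "graph (exchange_subgraph E \<I> p q)"
proof -
  have fin: "finite (indep_of_size \<I> l)" for l
    using finite_family by (simp add: indep_of_size_def)
  have "finite ((\<I> \<times> \<I>) \<times> (\<I> \<times> \<I>))" using finite_family by simp
  then have finarcs: "finite {(x, y). x \<in> \<I> \<times> \<I> \<and> y \<in> \<I> \<times> \<I> \<and> exchange_adjacent E x y}"
    by (rule rev_finite_subset) blast
  show ?thesis
    using fin finarcs
    by unfold_locales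
      (auto simp: exchange_subgraph_def exchange_graph_def arc_to_ends_def symmetric_conv
        exchange_adjacent_irrefl dest: exchange_adjacent_sym)
qed

end

end

theory Submission
  imports Defs
begin

text \<open>Along a path the multiset union is constant, and so is the MCP, because an element of a
  codependent pair is spanned by the other side and cannot be moved. For the converse, contract
  \<open>I \<inter> J\<close> to get two complementary independent sets. The claim is then proved for two different
  matroids on one ground set, so that it is stable under contracting an element in one matroid while
  deleting it in the other. The role of the MCP is played by the tight sets \<open>X\<close>, those with
  \<open>card X = rk1 X + rk2 X\<close>, and the proof is by induction on the ground set. A nonempty tight set
  is frozen and can be contracted. If there is none, every element moves at some time. After at
  most one move both states agree on some \<open>e\<close>, say it lies in the first component of both. The
  largest tight set \<open>X\<close> of the minors that fix \<open>e\<close> obstructs a direct use of the induction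
  hypothesis for them. Walk until \<open>e\<close> becomes movable; then the part of the state inside
  \<open>insert e X\<close> can be rearranged independently of the rest, by induction, to match the target, and
  the obstruction disappears.\<close>

section \<open>Bases and contractions\<close>

text \<open>For independent \<open>K\<close> disjoint from \<open>S\<close> this is the minor that
  contracts \<open>K\<close> and deletes what lies outside \<open>S \<union> K\<close>; for
  \<open>K = {}\<close> it is the restriction to \<open>S\<close>. Working with an independent
  \<open>K\<close> avoids choosing a basis of the contracted set.\<close>

definition contraction :: "'a set set \<Rightarrow> 'a set \<Rightarrow> 'a set \<Rightarrow> 'a set set" where
  "contraction F K S = {X. X \<subseteq> S \<and> X \<union> K \<in> F}"

lemma contraction_empty: "contraction F {} S = {X \<in> F. X \<subseteq> S}"
  by (auto simp: contraction_def)

context matroid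
begin

lemma basis_maximal:
  assumes "X \<in> \<I>" "X \<subseteq> A" "card X = rk \<I> A" "x \<in> A" "insert x X \<in> \<I>"
  shows "x \<in> X"
proof (rule ccontr)
  assume "x \<notin> X"
  then have "card (insert x X) = Suc (card X)" using finite_indep[OF assms(1)] by simp
  moreover have "card (insert x X) \<le> rk \<I> A" using card_le_rk assms by blast
  ultimately show False using assms(3) by simp
qed

lemma maximal_is_basis:
  assumes "X \<in> \<I>" "X \<subseteq> A" "\<And>x. x \<in> A - X \<Longrightarrow> insert x X \<notin> \<I>"
  shows "card X = rk \<I> A"
proof (rule ccontr)
  assume "card X \<noteq> rk \<I> A"
  then have "card X < rk \<I> A" using card_le_rk[OF assms(1,2)] by simp
  then show False using augment_in[OF assms(1)] assms(3) by blast
qed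

lemma rk_insert_le: "rk \<I> (insert x A) \<le> Suc (rk \<I> A)"
proof -
  obtain X where X: "X \<in> \<I>" "X \<subseteq> insert x A" "card X = rk \<I> (insert x A)"
    using rk_witness by blast
  have "card (X - {x}) \<le> rk \<I> A" using X indep_mono[OF X(1), of "X - {x}"] by (intro card_le_rk) auto
  moreover have "card X \<le> Suc (card (X - {x}))"
    using card_Suc_Diff1[OF finite_indep[OF X(1)], of x] by (cases "x \<in> X") simp_all
  ultimately show ?thesis using X(3) by linarith
qed

text \<open>A basis of \<open>Y \<union> X\<close> that extends \<open>K\<close> takes nothing else
  from \<open>X\<close>, since \<open>K\<close> is already maximal there.\<close>

lemma rk_Un_basis:
  assumes "K \<in> \<I>" "K \<subseteq> X" "card K = rk \<I> X"
  shows "rk \<I> (Y \<union> K) = rk \<I> (Y \<union> X)"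
proof (rule antisym)
  show "rk \<I> (Y \<union> K) \<le> rk \<I> (Y \<union> X)" using assms by (intro rk_mono) blast
  obtain B where B: "B \<in> \<I>" "K \<subseteq> B" "B \<subseteq> Y \<union> X" "card B = rk \<I> (Y \<union> X)"
    using extend_basis[of K "Y \<union> X"] assms by blast
  have "B \<inter> X \<subseteq> K"
  proof
    fix x assume x: "x \<in> B \<inter> X"
    then have "insert x K \<in> \<I>" using B indep_mono[OF B(1)] by blast
    then show "x \<in> K" using basis_maximal[OF assms] x by blast
  qed
  then have "B \<subseteq> Y \<union> K" using B by blast
  then show "rk \<I> (Y \<union> X) \<le> rk \<I> (Y \<union> K)" using card_le_rk B by metis
qed

text \<open>An element of \<open>Y \<union> Z\<close> that could be added would already be addable
  inside \<open>Y\<close> or inside \<open>Z\<close>. This makes tight sets closed under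
  union.\<close>

lemma basis_Un:
  assumes "K \<in> \<I>" "card (K \<inter> Y) = rk \<I> Y" "card (K \<inter> Z) = rk \<I> Z"
  shows "card (K \<inter> (Y \<union> Z)) = rk \<I> (Y \<union> Z)"
proof (rule maximal_is_basis)
  show "K \<inter> (Y \<union> Z) \<in> \<I>" using indep_mono[OF assms(1)] by blast
  fix x assume x: "x \<in> Y \<union> Z - K \<inter> (Y \<union> Z)"
  show "insert x (K \<inter> (Y \<union> Z)) \<notin> \<I>"
  proof
    assume ins: "insert x (K \<inter> (Y \<union> Z)) \<in> \<I>"
    have "insert x (K \<inter> Y) \<in> \<I>" "insert x (K \<inter> Z) \<in> \<I>"
      by (rule indep_mono[OF ins]; blast)+
    moreover have "K \<inter> Y \<in> \<I>" "K \<inter> Z \<in> \<I>"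
      by (rule indep_mono[OF assms(1)]; blast)+
    ultimately have "x \<in> Y \<Longrightarrow> x \<in> K \<inter> Y" "x \<in> Z \<Longrightarrow> x \<in> K \<inter> Z"
      using basis_maximal[of "K \<inter> Y" Y x] basis_maximal[of "K \<inter> Z" Z x] assms(2,3) by auto
    then show False using x by blast
  qed
qed blast

text \<open>A basis of \<open>Y \<union> B\<close> built over \<open>Z\<close> meets
  \<open>Y\<close> in a basis of \<open>Y\<close>; having at least \<open>card B\<close> elements,
  it must contain all of \<open>B - Y\<close>. This lets a state be rearranged inside
  \<open>Y\<close> without regard to its part outside.\<close>

lemma basis_replace:
  assumes "B \<in> \<I>" "card (B \<inter> Y) = rk \<I> Y" "Z \<in> \<I>" "Z \<subseteq> Y"
  shows "Z \<union> (B - Y) \<in> \<I>"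
proof -
  obtain Z' where Z': "Z' \<in> \<I>" "Z \<subseteq> Z'" "Z' \<subseteq> Y" "card Z' = rk \<I> Y"
    using extend_basis[OF assms(3,4)] by blast
  obtain W where W: "W \<in> \<I>" "Z' \<subseteq> W" "W \<subseteq> Y \<union> B" "card W = rk \<I> (Y \<union> B)"
    using extend_basis[of Z' "Y \<union> B"] Z' by blast
  have "W \<inter> Y \<subseteq> Z'"
  proof
    fix x assume x: "x \<in> W \<inter> Y"
    then have "insert x Z' \<in> \<I>" using W indep_mono[OF W(1)] by blast
    then show "x \<in> Z'" using basis_maximal[OF Z'(1,3,4)] x by blast
  qed
  then have sub: "W \<subseteq> Z' \<union> (B - Y)" using W by blast
  have fin: "finite Z'" "finite B" using finite_indep Z' assms by auto
  have "card (Z' \<union> (B - Y)) \<le> card Z' + card (B - Y)" by (rule card_Un_le)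
  also have "\<dots> = card (B \<inter> Y) + card (B - Y)" using Z' assms by simp
  also have "\<dots> = card B" using fin by (metis card_Int_Diff)
  also have "\<dots> \<le> card W" using W card_le_rk[OF assms(1), of "Y \<union> B"] by simp
  finally have "W = Z' \<union> (B - Y)" using sub fin by (meson card_seteq finite_Diff finite_UnI)
  then have "Z \<union> (B - Y) \<subseteq> W" using Z' by blast
  then show ?thesis using indep_mono[OF W(1)] by blast
qed

lemma matroid_contraction:
  assumes "K \<in> \<I>" "S \<subseteq> E" "S \<inter> K = {}"
  shows "matroid S (contraction \<I> K S)"
proof
  show "finite S" using finite_ground assms finite_subset by blast
  show "{} \<in> contraction \<I> K S" using assms by (simp add: contraction_def)
next
  fix X Y assume XY: "X \<in> contraction \<I> K S" "Y \<in> contraction \<I> K S" "card X < card Y"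
  then have "X \<union> K \<in> \<I>" "Y \<union> K \<in> \<I>" "X \<inter> K = {}" "Y \<inter> K = {}"
    using assms by (auto simp: contraction_def)
  moreover from this XY(3) have "card (X \<union> K) < card (Y \<union> K)"
    using finite_indep[of "X \<union> K"] finite_indep[of "Y \<union> K"] by (simp add: card_Un_disjoint)
  ultimately obtain x where "x \<in> (Y \<union> K) - (X \<union> K)" "insert x (X \<union> K) \<in> \<I>"
    using augment by metis
  then show "\<exists>x \<in> Y - X. insert x X \<in> contraction \<I> K S"
    using XY by (auto simp: contraction_def)
next
  fix X Y assume "Y \<in> contraction \<I> K S" "X \<subseteq> Y"
  then show "X \<in> contraction \<I> K S"
    using indep_mono[of "Y \<union> K" "X \<union> K"] by (auto simp: contraction_def)
qed (auto simp: contraction_def)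

lemma rk_contraction:
  assumes "K \<in> \<I>" "S \<subseteq> E" "S \<inter> K = {}" "X \<subseteq> S"
  shows "rk (contraction \<I> K S) X + card K = rk \<I> (X \<union> K)"
proof (rule antisym)
  interpret C: matroid S "contraction \<I> K S" using matroid_contraction assms by blast
  obtain B where B: "B \<in> contraction \<I> K S" "B \<subseteq> X" "card B = rk (contraction \<I> K S) X"
    using C.rk_witness by blast
  then have "B \<union> K \<in> \<I>" "B \<inter> K = {}" using assms by (auto simp: contraction_def)
  then have "card B + card K = card (B \<union> K)"
    using finite_indep[of "B \<union> K"] by (simp add: card_Un_disjoint)
  also have "\<dots> \<le> rk \<I> (X \<union> K)" using \<open>B \<union> K \<in> \<I>\<close> B by (intro card_le_rk) auto
  finally show "rk (contraction \<I> K S) X + card K \<le> rk \<I> (X \<union> K)" using B by simp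
  obtain W where W: "W \<in> \<I>" "K \<subseteq> W" "W \<subseteq> X \<union> K" "card W = rk \<I> (X \<union> K)"
    using extend_basis[of K "X \<union> K"] assms by blast
  then have "W - K \<in> contraction \<I> K S"
    using assms by (auto simp: contraction_def Un_absorb2)
  then have "card (W - K) \<le> rk (contraction \<I> K S) X" using W by (intro C.card_le_rk) auto
  moreover have "card W = card (W - K) + card K"
    using W finite_indep by (metis card_Diff_subset card_mono finite_subset le_add_diff_inverse2)
  ultimately show "rk \<I> (X \<union> K) \<le> rk (contraction \<I> K S) X + card K" using W by simp
qed

lemma rk_restriction:
  assumes "S \<subseteq> E" "X \<subseteq> S"
  shows "rk (contraction \<I> {} S) X = rk \<I> X"
  using rk_contraction[OF indep_empty assms(1) Int_empty_right assms(2)] by simp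

text \<open>The fundamental circuit of \<open>u\<close> does not change while no move is able to break it.\<close>

lemma circuit_element_stays:
  assumes step: "\<And>s t. R s t \<Longrightarrow> (\<exists>x. x \<notin> f s \<and> f t = insert x (f s) \<and> card (f s) = q) \<or>
                                 (\<exists>x. x \<notin> f t \<and> f s = insert x (f t) \<and> card (f t) = q)"
    and indep: "\<And>t. R\<^sup>*\<^sup>* s t \<Longrightarrow> f t \<in> \<I> \<and> u \<notin> f t"
    and blocked: "\<And>t. R\<^sup>*\<^sup>* s t \<Longrightarrow> card (f t) = q \<Longrightarrow> insert u (f t) \<notin> \<I>"
    and y: "y \<in> f s" "insert u (f s) - {y} \<in> \<I>"
    and walk: "R\<^sup>*\<^sup>* s t"
  shows "y \<in> f t \<and> insert u (f t) - {y} \<in> \<I>"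
  using walk
proof (induction rule: rtranclp_induct)
  case base
  then show ?case using y by blast
next
  case (step t t')
  have t: "f t \<in> \<I>" "u \<notin> f t" and t': "f t' \<in> \<I>" "u \<notin> f t'"
    using indep step.hyps by (auto intro: rtranclp.rtrancl_into_rtrancl)
  have fin: "finite (f t)" "finite (f t')" using finite_indep t t' by auto
  from assms(1)[OF step.hyps(2)] show ?case
  proof
    assume "\<exists>x. x \<notin> f t \<and> f t' = insert x (f t) \<and> card (f t) = q"
    then obtain x where x: "x \<notin> f t" "f t' = insert x (f t)" "card (f t) = q" by blast
    \<comment> \<open>The enlarged state augments \<open>insert u (f t) - {y}\<close>. The element
      gained cannot be \<open>y\<close>, for that would make \<open>insert u (f t)\<close>
      independent, so it is the newly added \<open>x\<close>.\<close>
    have "card (insert u (f t) - {y}) = card (f t)"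
      using step.IH t fin by (simp add: card_Diff_singleton)
    then have "card (insert u (f t) - {y}) < card (f t')" using x fin by simp
    then obtain z where z: "z \<in> f t' - (insert u (f t) - {y})" "insert z (insert u (f t) - {y}) \<in> \<I>"
      using augment step.IH t' by metis
    have "z \<noteq> y"
    proof
      assume "z = y"
      then have "insert u (f t) \<in> \<I>" using indep_mono[OF z(2)] by blast
      then show False using blocked step.hyps x by blast
    qed
    then have "z = x" using z x by blast
    moreover have "x \<noteq> y" using x step.IH by blast
    ultimately have "insert u (f t') - {y} = insert z (insert u (f t) - {y})"
      unfolding x(2) by blast
    then have "insert u (f t') - {y} \<in> \<I>" using z(2) by simp
    then show ?thesis using x step.IH by blast
  next
    assume "\<exists>x. x \<notin> f t' \<and> f t = insert x (f t') \<and> card (f t') = q"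
    then obtain x where x: "x \<notin> f t'" "f t = insert x (f t')" "card (f t') = q" by blast
    \<comment> \<open>If \<open>y\<close> were the element removed, \<open>insert u (f t')\<close>
      would be independent and \<open>u\<close> would no longer be blocked.\<close>
    have "x \<noteq> y"
    proof
      assume "x = y"
      then have "insert u (f t) - {y} = insert u (f t')" using x t by auto
      then have "insert u (f t') \<in> \<I>" using step.IH by simp
      then show False
        using blocked[OF rtranclp.rtrancl_into_rtrancl[OF step.hyps]] x by blast
    qed
    then have "y \<in> f t'" using x(2) step.IH by simp
    moreover have "insert u (f t') - {y} \<in> \<I>"
      by (rule indep_mono[of "insert u (f t) - {y}"]) (use step.IH x(2) in blast)+
    ultimately show ?thesis by blast
  qed
qed

text \<open>If this set were independent, a basis of \<open>insert u (f s)\<close> containing it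
  would omit some \<open>y\<close> of the fundamental circuit of \<open>u\<close>. By
  \<open>circuit_element_stays\<close> that \<open>y\<close> never leaves, so it belongs to the
  basis after all. Hence an element that can never enter is spanned by those that never
  leave.\<close>

lemma blocked_by_frozen:
  assumes step: "\<And>s t. R s t \<Longrightarrow> (\<exists>x. x \<notin> f s \<and> f t = insert x (f s) \<and> card (f s) = q) \<or>
                                 (\<exists>x. x \<notin> f t \<and> f s = insert x (f t) \<and> card (f t) = q)"
    and indep: "\<And>t. R\<^sup>*\<^sup>* s t \<Longrightarrow> f t \<in> \<I> \<and> u \<notin> f t"
    and blocked: "\<And>t. R\<^sup>*\<^sup>* s t \<Longrightarrow> card (f t) = q \<Longrightarrow> insert u (f t) \<notin> \<I>"
    and q: "card (f s) = q"
  shows "insert u {v. \<forall>t. R\<^sup>*\<^sup>* s t \<longrightarrow> v \<in> f t} \<notin> \<I>"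
proof
  let ?V = "{v. \<forall>t. R\<^sup>*\<^sup>* s t \<longrightarrow> v \<in> f t}"
  assume ins: "insert u ?V \<in> \<I>"
  have s: "f s \<in> \<I>" "u \<notin> f s" using indep by auto
  have fin: "finite (f s)" using finite_indep s by auto
  have "?V \<subseteq> f s" by blast
  then obtain W where W: "W \<in> \<I>" "insert u ?V \<subseteq> W" "W \<subseteq> insert u (f s)"
    "card W = rk \<I> (insert u (f s))"
    using extend_basis[OF ins, of "insert u (f s)"] by blast
  have "W \<noteq> insert u (f s)" using W(1) blocked q by blast
  then obtain y where y: "y \<in> insert u (f s)" "y \<notin> W" using W by blast
  then have ys: "y \<in> f s" using W by blast
  have "card (insert u (f s) - {y}) = card (f s)" using s fin ys by (simp add: card_Diff_singleton)
  also have "\<dots> \<le> card W" using W(4) card_le_rk[OF s(1), of "insert u (f s)"] by auto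
  finally have "W = insert u (f s) - {y}"
    using W(3) y fin by (intro card_seteq) auto
  then have "insert u (f s) - {y} \<in> \<I>" using W by simp
  then have "y \<in> ?V" using circuit_element_stays[where R = R and f = f and q = q and s = s and u = u, OF step indep blocked ys]
    by blast
  then show False using W y by blast
qed

end

section \<open>Exchanges between two matroids\<close>

text \<open>A state \<open>A\<close> stands for the pair \<open>(A, E - A)\<close> of complementary sets. Moves take place
  between the states of size \<open>k - 1\<close> and those of size \<open>k\<close>.\<close>

definition exch_up :: "'a set \<Rightarrow> 'a set set \<Rightarrow> 'a set set \<Rightarrow> nat \<Rightarrow> 'a set \<Rightarrow> 'a \<Rightarrow> bool" where
  "exch_up E F1 F2 k A x \<longleftrightarrow>
     A \<subseteq> E \<and> x \<in> E - A \<and> Suc (card A) = k \<and> insert x A \<in> F1 \<and> E - A \<in> F2"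

definition exch :: "'a set \<Rightarrow> 'a set set \<Rightarrow> 'a set set \<Rightarrow> nat \<Rightarrow> 'a set \<Rightarrow> 'a set \<Rightarrow> bool" where
  "exch E F1 F2 k A B \<longleftrightarrow> (\<exists>x. exch_up E F1 F2 k A x \<and> B = insert x A) \<or>
                          (\<exists>x. exch_up E F1 F2 k B x \<and> A = insert x B)"

text \<open>The moves to \<open>A'\<close> and \<open>B'\<close> say that the states are not
  isolated, and the sets \<open>X\<close> are those named \<open>tight\<close> below. The predicate
  stands outside the locale because the induction passes to smaller ground sets.\<close>

definition exch_connected :: "'a set \<Rightarrow> 'a set set \<Rightarrow> 'a set set \<Rightarrow> bool" where
  "exch_connected E F1 F2 \<longleftrightarrow> (\<forall>k A A' B B'. exch E F1 F2 k A A' \<longrightarrow> exch E F1 F2 k B B' \<longrightarrow>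
     (\<forall>X \<subseteq> E. card X = rk F1 X + rk F2 X \<longrightarrow> A \<inter> X = B \<inter> X) \<longrightarrow> (exch E F1 F2 k)\<^sup>*\<^sup>* A B)"

section \<open>Walks under complementation, lifting and contraction\<close>

lemma exch_sym: "exch E F1 F2 k A B \<Longrightarrow> exch E F1 F2 k B A"
  unfolding exch_def by blast

lemma exch_walk_sym: "(exch E F1 F2 k)\<^sup>*\<^sup>* A B \<Longrightarrow> (exch E F1 F2 k)\<^sup>*\<^sup>* B A"
  by (rule sympD[OF symp_rtranclp[OF sympI]]) (rule exch_sym)

text \<open>Complements interchange the two matroids and turn the sizes \<open>k - 1\<close> and
  \<open>k\<close> into \<open>l\<close> and \<open>l - 1\<close>. The same element \<open>x\<close>
  is moved, in the opposite direction.\<close>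

lemma exch_up_complement:
  assumes "finite E" "k + l = Suc (card E)" "exch_up E F1 F2 k A x"
  shows "exch_up E F2 F1 l (E - insert x A) x"
proof -
  have A: "A \<subseteq> E" "x \<in> E" "x \<notin> A" "Suc (card A) = k" "insert x A \<in> F1" "E - A \<in> F2"
    using assms(3) by (auto simp: exch_up_def)
  have fin: "finite A" using A assms(1) finite_subset by blast
  have "card (E - insert x A) = card E - card (insert x A)"
    using A fin by (intro card_Diff_subset) auto
  moreover have "card (insert x A) \<le> card E" using A assms(1) by (intro card_mono) auto
  ultimately have "Suc (card (E - insert x A)) = l" using A fin assms(2) by simp
  moreover have "insert x (E - insert x A) = E - A" "E - (E - insert x A) = insert x A" using A by auto
  ultimately show ?thesis using A by (simp add: exch_up_def)
qed

lemma exch_complement: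
  assumes "finite E" "k + l = Suc (card E)" "exch E F1 F2 k A B"
  shows "exch E F2 F1 l (E - A) (E - B)"
proof -
  have "exch E F2 F1 l (E - A) (E - insert x A) \<and> exch E F2 F1 l (E - insert x A) (E - A)"
    if "exch_up E F1 F2 k A x" for A x
  proof -
    have "E - A = insert x (E - insert x A)" using that by (auto simp: exch_up_def)
    with exch_up_complement[OF assms(1,2) that] show ?thesis
      unfolding exch_def by metis
  qed
  then show ?thesis using assms(3) unfolding exch_def by blast
qed

lemma exch_walk_complement:
  assumes "finite E" "k + l = Suc (card E)" "(exch E F1 F2 k)\<^sup>*\<^sup>* A B"
  shows "(exch E F2 F1 l)\<^sup>*\<^sup>* (E - A) (E - B)"
  using assms(3)
proof (induction rule: rtranclp_induct)
  case (step B C)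
  then show ?case using exch_complement[OF assms(1,2)] by (meson rtranclp.rtrancl_into_rtrancl)
qed simp

lemma exch_walk_lift:
  assumes "\<And>A x. exch_up S G1 G2 j A x \<Longrightarrow> exch_up E F1 F2 k (A \<union> L) x"
    and "(exch S G1 G2 j)\<^sup>*\<^sup>* A B"
  shows "(exch E F1 F2 k)\<^sup>*\<^sup>* (A \<union> L) (B \<union> L)"
  using assms(2)
proof (induction rule: rtranclp_induct)
  case (step B C)
  have "exch E F1 F2 k (B \<union> L) (C \<union> L)"
    using step.hyps(2) assms(1) unfolding exch_def by (metis Un_insert_left)
  then show ?case using step.IH by (rule rtranclp.rtrancl_into_rtrancl[rotated])
qed simp

text \<open>Elements of \<open>K1\<close> are frozen inside the state and those of \<open>K2\<close>
  outside it. So \<open>K1\<close> is contracted in \<open>F1\<close> and deleted in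
  \<open>F2\<close>, and \<open>K2\<close> the other way round.\<close>

lemma exch_up_contraction_iff:
  assumes "finite E" "E = S \<union> K1 \<union> K2" "S \<inter> K1 = {}" "S \<inter> K2 = {}" "K1 \<inter> K2 = {}" "A \<subseteq> S" "x \<in> S"
  shows "exch_up S (contraction F1 K1 S) (contraction F2 K2 S) j A x \<longleftrightarrow>
    exch_up E F1 F2 (j + card K1) (A \<union> K1) x"
proof -
  have "card (A \<union> K1) = card A + card K1"
    using assms finite_subset[of A E] finite_subset[of K1 E] by (intro card_Un_disjoint) auto
  moreover have "E - (A \<union> K1) = (S - A) \<union> K2" using assms(2-6) by auto
  moreover have "x \<in> E - (A \<union> K1) \<longleftrightarrow> x \<in> S - A" using assms by auto
  ultimately show ?thesis using assms(2,6,7) by (auto simp: exch_up_def contraction_def)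
qed

section \<open>States and tight sets of a pair of matroids\<close>

locale matroid_pair = M1: matroid E F1 + M2: matroid E F2
  for E :: "'a set" and F1 F2 :: "'a set set"
begin

definition state :: "'a set \<Rightarrow> bool" where
  "state A \<longleftrightarrow> A \<subseteq> E \<and> A \<in> F1 \<and> E - A \<in> F2"

text \<open>A state splits \<open>X\<close> into independent sets of the two matroids, so in its
  presence the left side is at most the right side. Equality means that every state splits
  \<open>X\<close> into a basis for \<open>F1\<close> and a basis for \<open>F2\<close>.\<close>

definition tight :: "'a set \<Rightarrow> bool" where
  "tight X \<longleftrightarrow> X \<subseteq> E \<and> card X = rk F1 X + rk F2 X"

lemma swap: "matroid_pair E F2 F1"
  by unfold_locales

lemma exch_upD:
  assumes "exch_up E F1 F2 k A x"
  shows "state A" "state (insert x A)" "x \<in> E" "x \<notin> A" "card (insert x A) = k" "Suc (card A) = k"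
    "k \<le> rk F1 E" "k \<le> card E"
proof -
  have A: "A \<subseteq> E" "x \<in> E" "x \<notin> A" "Suc (card A) = k" "insert x A \<in> F1" "E - A \<in> F2"
    using assms by (auto simp: exch_up_def)
  have "A \<in> F1" "E - insert x A \<in> F2"
    using A M1.indep_mono[of "insert x A" A] M2.indep_mono[of "E - A" "E - insert x A"] by auto
  then show "state A" "state (insert x A)" using A by (auto simp: state_def)
  have fin: "finite A" using A M1.finite_ground finite_subset by blast
  show c: "card (insert x A) = k" using A fin by simp
  have sub: "insert x A \<subseteq> E" using A by blast
  show "k \<le> rk F1 E" using M1.card_le_rk[OF A(5) sub] c by simp
  show "k \<le> card E" using card_mono[OF M1.finite_ground sub] c by simp
qed (use assms in \<open>auto simp: exch_up_def\<close>)

lemma exch_state: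
  assumes "exch E F1 F2 k A B"
  shows "state A" "state B" "card A = k \<or> Suc (card A) = k" "k \<le> rk F1 E" "k \<le> card E"
proof -
  have "state A \<and> state B \<and> (card A = k \<or> Suc (card A) = k) \<and> k \<le> rk F1 E \<and> k \<le> card E"
    using assms unfolding exch_def
  proof (elim disjE exE conjE)
    fix x assume "exch_up E F1 F2 k A x" "B = insert x A"
    then show ?thesis using exch_upD[of k A x] by simp
  next
    fix x assume "exch_up E F1 F2 k B x" "A = insert x B"
    then show ?thesis using exch_upD[of k B x] by simp
  qed
  then show "state A" "state B" "card A = k \<or> Suc (card A) = k" "k \<le> rk F1 E" "k \<le> card E"
    by auto
qed

lemma exch_walk_state:
  assumes "(exch E F1 F2 k)\<^sup>*\<^sup>* A B" "state A"
  shows "state B"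
  using assms by (induction rule: rtranclp_induct) (auto dest: exch_state(2))

lemma exch_up_remove:
  assumes "state A" "card A = k" "x \<in> A" "insert x (E - A) \<in> F2"
  shows "exch_up E F1 F2 k (A - {x}) x"
proof -
  have fin: "finite A" using assms(1) M1.finite_indep by (simp add: state_def)
  have "E - (A - {x}) = insert x (E - A)" using assms by (auto simp: state_def)
  moreover have "Suc (card (A - {x})) = k" using card_Suc_Diff1[OF fin assms(3)] assms(2) by simp
  ultimately show ?thesis using assms by (auto simp: exch_up_def state_def insert_absorb)
qed

lemma state_rank:
  assumes "state A" "X \<subseteq> E"
  shows "card (A \<inter> X) \<le> rk F1 X" "card (X - A) \<le> rk F2 X"
    "card X = card (A \<inter> X) + card (X - A)"
proof -
  have "A \<inter> X \<in> F1" using assms M1.indep_mono[of A] by (simp add: state_def)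
  then show "card (A \<inter> X) \<le> rk F1 X" by (rule M1.card_le_rk) blast
  have "X - A \<in> F2" using assms M2.indep_mono[of "E - A" "X - A"] by (auto simp: state_def)
  then show "card (X - A) \<le> rk F2 X" by (rule M2.card_le_rk) blast
  show "card X = card (A \<inter> X) + card (X - A)"
    using card_Int_Diff[of X A] finite_subset[OF assms(2) M1.finite_ground] by (simp add: Int_commute)
qed

lemma tight_iff:
  assumes "state A" "X \<subseteq> E"
  shows "tight X \<longleftrightarrow> card (A \<inter> X) = rk F1 X \<and> card (X - A) = rk F2 X"
  using state_rank[OF assms] assms(2) unfolding tight_def by linarith

lemma not_tight_less:
  assumes "state A" "X \<subseteq> E" "\<not> tight X"
  shows "card X < rk F1 X + rk F2 X"
  using state_rank[OF assms(1,2)] assms(2,3) unfolding tight_def by linarith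

lemma tight_Un:
  assumes "state A" "tight X" "tight Y"
  shows "tight (X \<union> Y)"
proof -
  have sub: "X \<subseteq> E" "Y \<subseteq> E" using assms by (auto simp: tight_def)
  then have eq: "(E - A) \<inter> X = X - A" "(E - A) \<inter> Y = Y - A" "(E - A) \<inter> (X \<union> Y) = X \<union> Y - A"
    by auto
  have A: "A \<in> F1" "E - A \<in> F2" using assms(1) by (auto simp: state_def)
  have "card (A \<inter> (X \<union> Y)) = rk F1 (X \<union> Y)"
    using tight_iff[OF assms(1)] assms(2,3) sub by (intro M1.basis_Un[OF A(1)]) auto
  moreover have "card ((E - A) \<inter> (X \<union> Y)) = rk F2 (X \<union> Y)"
    using tight_iff[OF assms(1)] assms(2,3) sub by (intro M2.basis_Un[OF A(2)]) (simp_all only: eq)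
  ultimately show ?thesis using tight_iff[OF assms(1), of "X \<union> Y"] sub eq by simp
qed

lemma ex_largest_tight:
  assumes "state A"
  obtains X where "tight X" "\<And>Y. tight Y \<Longrightarrow> Y \<subseteq> X"
proof -
  let ?T = "Collect tight"
  have "?T \<subseteq> Pow E" by (auto simp: tight_def)
  then have fin: "finite ?T" using M1.finite_ground finite_subset by blast
  have "card (A \<inter> {}) = rk F1 {}" "card ({} - A) = rk F2 {}"
    using M1.maximal_is_basis[OF M1.indep_empty, of "{}"] M2.maximal_is_basis[OF M2.indep_empty, of "{}"]
    by auto
  then have "tight {}" using tight_iff[OF assms, of "{}"] by simp
  then have "?T \<noteq> {}" by blast
  then have "Max (card ` ?T) \<in> card ` ?T" using fin by (intro Max_in) auto
  then obtain X where X: "tight X" "card X = Max (card ` ?T)" by auto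
  have le: "card Y \<le> card X" if "tight Y" for Y
    using X(2) that fin by simp
  have "Y \<subseteq> X" if "tight Y" for Y
  proof -
    have t: "tight (X \<union> Y)" using tight_Un assms X that by blast
    then have "finite (X \<union> Y)" using M1.finite_ground finite_subset by (auto simp: tight_def)
    then have "X = X \<union> Y" using le[OF t] by (intro card_seteq) auto
    then show ?thesis by blast
  qed
  then show ?thesis using that X by blast
qed

text \<open>Both ends of a move meet \<open>X\<close> in sets of size \<open>rk F1 X\<close>, one
  containing the other, so the moved element is outside \<open>X\<close>.\<close>

lemma exch_tight:
  assumes "exch E F1 F2 k A B" "tight X"
  shows "A \<inter> X = B \<inter> X"
proof -
  have sub: "X \<subseteq> E" using assms by (simp add: tight_def)
  have fin: "finite X" using sub M1.finite_ground finite_subset by blast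
  have "A \<inter> X = insert x A \<inter> X" if up: "exch_up E F1 F2 k A x" for A x
  proof -
    have "card (A \<inter> X) = card (insert x A \<inter> X)"
      using tight_iff[OF _ sub] exch_upD(1,2)[OF up] assms(2) by metis
    then show ?thesis using fin by (intro card_seteq) auto
  qed
  then show ?thesis using assms(1) unfolding exch_def by metis
qed

section \<open>Induction on the ground set: walks obtained from minors\<close>

lemma contraction_pair:
  assumes "K1 \<in> F1" "K2 \<in> F2" "S \<subseteq> E" "S \<inter> K1 = {}" "S \<inter> K2 = {}"
  shows "matroid_pair S (contraction F1 K1 S) (contraction F2 K2 S)"
  using M1.matroid_contraction M2.matroid_contraction assms by (simp add: matroid_pair_def)

text \<open>A walk in the minor lifts to a walk that keeps \<open>K1\<close> inside and
  \<open>K2\<close> outside. The neighbours \<open>A'\<close> and \<open>B'\<close> must respect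
  this too, so that neither state becomes isolated in the minor.\<close>

lemma walk_by_contraction:
  assumes E: "E = S \<union> K1 \<union> K2" "S \<inter> K1 = {}" "S \<inter> K2 = {}" "K1 \<inter> K2 = {}"
    and conn: "exch_connected S (contraction F1 K1 S) (contraction F2 K2 S)"
    and moves: "exch E F1 F2 k A A'" "exch E F1 F2 k B B'"
    and K1: "K1 \<subseteq> A" "K1 \<subseteq> A'" "K1 \<subseteq> B" "K1 \<subseteq> B'"
    and K2: "K2 \<inter> A = {}" "K2 \<inter> A' = {}" "K2 \<inter> B = {}" "K2 \<inter> B' = {}"
    and agree: "\<And>X. X \<subseteq> S \<Longrightarrow> card X = rk (contraction F1 K1 S) X + rk (contraction F2 K2 S) X
      \<Longrightarrow> A \<inter> X = B \<inter> X"
  shows "(exch E F1 F2 k)\<^sup>*\<^sup>* A B"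
proof -
  note iff = exch_up_contraction_iff[OF M1.finite_ground E]
  define G1 where "G1 = contraction F1 K1 S"
  define G2 where "G2 = contraction F2 K2 S"
  have fin: "finite E" by (rule M1.finite_ground)
  have "card K1 \<le> k"
  proof -
    have "A \<subseteq> E" using exch_state(1)[OF moves(1)] by (simp add: state_def)
    then have "card K1 \<le> card A" using fin K1 by (intro card_mono) (auto intro: finite_subset)
    then show ?thesis using exch_state(3)[OF moves(1)] by linarith
  qed
  then obtain j where j: "k = j + card K1" using nat_le_iff_add[of "card K1" k] by (auto simp: add.commute)
  have restr_up: "exch_up S G1 G2 j (Y - K1) x"
    if up: "exch_up E F1 F2 k Y x" "K1 \<subseteq> Y" "K2 \<inter> insert x Y = {}" for Y x
  proof -
    have "Y \<subseteq> E" "x \<in> E" "x \<notin> Y" using up by (auto simp: exch_up_def)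
    then have "Y - K1 \<subseteq> S" "x \<in> S" using up E by auto
    moreover have "Y - K1 \<union> K1 = Y" using up by blast
    ultimately show ?thesis using iff[of "Y - K1" x F1 F2 j] up j by (simp add: G1_def G2_def)
  qed
  have restr: "exch S G1 G2 j (Y - K1) (Y' - K1)"
    if "exch E F1 F2 k Y Y'" "K1 \<subseteq> Y" "K1 \<subseteq> Y'" "K2 \<inter> Y = {}" "K2 \<inter> Y' = {}" for Y Y'
    using that(1) unfolding exch_def
  proof (elim disjE exE conjE)
    fix x assume x: "exch_up E F1 F2 k Y x" "Y' = insert x Y"
    then have "x \<notin> K1" using that by (auto simp: exch_up_def)
    then have "Y' - K1 = insert x (Y - K1)" using x by blast
    then show "(\<exists>x. exch_up S G1 G2 j (Y - K1) x \<and> Y' - K1 = insert x (Y - K1)) \<or>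
      (\<exists>x. exch_up S G1 G2 j (Y' - K1) x \<and> Y - K1 = insert x (Y' - K1))"
      using restr_up[OF x(1)] that x(2) by blast
  next
    fix x assume x: "exch_up E F1 F2 k Y' x" "Y = insert x Y'"
    then have "x \<notin> K1" using that by (auto simp: exch_up_def)
    then have "Y - K1 = insert x (Y' - K1)" using x by blast
    then show "(\<exists>x. exch_up S G1 G2 j (Y - K1) x \<and> Y' - K1 = insert x (Y - K1)) \<or>
      (\<exists>x. exch_up S G1 G2 j (Y' - K1) x \<and> Y - K1 = insert x (Y' - K1))"
      using restr_up[OF x(1)] that x(2) by blast
  qed
  have "(A - K1) \<inter> X = (B - K1) \<inter> X" if "X \<subseteq> S" "card X = rk G1 X + rk G2 X" for X
    using agree[of X] that E(2) by (auto simp: G1_def G2_def)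
  then have "(exch S G1 G2 j)\<^sup>*\<^sup>* (A - K1) (B - K1)"
    using conn[folded G1_def G2_def, unfolded exch_connected_def, rule_format,
        OF restr[OF moves(1) K1(1,2) K2(1,2)] restr[OF moves(2) K1(3,4) K2(3,4)]] by simp
  then have "(exch E F1 F2 k)\<^sup>*\<^sup>* (A - K1 \<union> K1) (B - K1 \<union> K1)"
  proof (rule exch_walk_lift[rotated])
    fix Y x assume up: "exch_up S G1 G2 j Y x"
    then have "Y \<subseteq> S" "x \<in> S" by (auto simp: exch_up_def)
    from iff[OF this] up j show "exch_up E F1 F2 k (Y \<union> K1) x" by (simp add: G1_def G2_def)
  qed
  moreover have "A - K1 \<union> K1 = A" "B - K1 \<union> K1 = B" using K1 by auto
  ultimately show ?thesis by simp
qed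

text \<open>If \<open>e\<close> can never be moved, then the set of all elements that are never moved is tight.\<close>

lemma reach_movable:
  assumes no_tight: "\<And>X. tight X \<Longrightarrow> X = {}"
    and move: "exch E F1 F2 k A A'" and e: "e \<in> A"
  obtains A1 where "(exch E F1 F2 k)\<^sup>*\<^sup>* A A1" "e \<in> A1" "exch_up E F1 F2 k (A1 - {e}) e"
proof (rule ccontr)
  note found = that
  let ?R = "exch E F1 F2 k"
  define C where "C t \<longleftrightarrow> ?R\<^sup>*\<^sup>* A t" for t
  assume "\<not> thesis"
  then have never: "\<not> exch_up E F1 F2 k (t - {e}) e" if "C t" "e \<in> t" for t
    using found that by (auto simp: C_def)
  have fin: "finite E" by (rule M1.finite_ground)
  have closed: "C t'" if "C t" "?R t t'" for t t'
    using that by (auto simp: C_def)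
  have st: "state t" if "C t" for t
    using exch_walk_state that exch_state(1)[OF move] by (auto simp: C_def)
  have e_in: "e \<in> t" if "C t" for t
    using that unfolding C_def
  proof (induction rule: rtranclp_induct)
    case (step t t')
    show ?case
    proof (rule ccontr)
      assume "e \<notin> t'"
      then have up: "exch_up E F1 F2 k t' e" "t = insert e t'"
        using step.hyps(2) step.IH by (auto simp: exch_def)
      then have "t - {e} = t'" using \<open>e \<notin> t'\<close> by blast
      then show False using never[of t] step.hyps(1) step.IH up by (simp add: C_def)
    qed
  qed (rule e)
  have walk_iff: "?R\<^sup>*\<^sup>* s t \<longleftrightarrow> C t" if "C s" for s t
    using that exch_walk_sym unfolding C_def by (meson rtranclp_trans)
  \<comment> \<open>\<open>blocked_by_frozen\<close> starts at the smaller of the two sizes, which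
    is that of \<open>s1\<close> for \<open>F1\<close> and that of the complement of
    \<open>s2\<close> for \<open>F2\<close>.\<close>
  obtain s1 s2 where s: "C s1" "C s2" "Suc (card s1) = k" "card s2 = k"
  proof -
    have "C A" "C A'" using closed[OF _ move] by (auto simp: C_def)
    then show ?thesis using that move exch_upD(5,6) unfolding exch_def by metis
  qed
  have k: "k \<le> card E" using exch_state(5)[OF move] .
  have card_compl: "card (E - t) = card E - card t" "card t \<le> card E" if "C t" for t
    using st[OF that] fin by (auto simp: state_def intro: card_Diff_subset card_mono finite_subset)
  define U where "U = {v. \<forall>t. C t \<longrightarrow> v \<in> t}"
  define V where "V = {v. \<forall>t. C t \<longrightarrow> v \<in> E - t}"
  have step1: "(\<exists>x. x \<notin> s \<and> t = insert x s \<and> card s = k - 1) \<or>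
      (\<exists>x. x \<notin> t \<and> s = insert x t \<and> card t = k - 1)" if "?R s t" for s t
    using that by (auto simp: exch_def exch_up_def)
  have stepE: "x \<notin> E - insert x s \<and> E - s = insert x (E - insert x s) \<and>
      card (E - insert x s) = card E - k" if up: "exch_up E F1 F2 k s x" for s x
  proof -
    have "insert x s \<subseteq> E" using up by (auto simp: exch_up_def)
    then have "card (E - insert x s) = card E - k"
      using exch_upD(5)[OF up] fin by (metis card_Diff_subset finite_subset)
    then show ?thesis using up by (auto simp: exch_up_def)
  qed
  have step2: "(\<exists>x. x \<notin> E - s \<and> E - t = insert x (E - s) \<and> card (E - s) = card E - k) \<or>
      (\<exists>x. x \<notin> E - t \<and> E - s = insert x (E - t) \<and> card (E - t) = card E - k)" if "?R s t" for s t
    using that stepE unfolding exch_def by metis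
  have blockU: "insert u V \<notin> F2" if u: "u \<in> U" for u
  proof -
    have "insert u {v. \<forall>t. ?R\<^sup>*\<^sup>* s2 t \<longrightarrow> v \<in> E - t} \<notin> F2"
    proof (rule M2.blocked_by_frozen[where q = "card E - k"])
      fix t assume "?R\<^sup>*\<^sup>* s2 t"
      then have t: "C t" using walk_iff s by blast
      then have ut: "u \<in> t" using u by (auto simp: U_def)
      then show "E - t \<in> F2 \<and> u \<notin> E - t" using st[OF t] by (auto simp: state_def)
      assume "card (E - t) = card E - k"
      then have kt: "card t = k" using card_compl[OF t] k by linarith
      \<comment> \<open>Adding \<open>u\<close> to the complement amounts to removing it from the
        state, a legal move that a frozen \<open>u\<close> excludes.\<close>
      show "insert u (E - t) \<notin> F2"
      proof
        assume "insert u (E - t) \<in> F2"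
        from exch_up_remove[OF st[OF t] kt ut this] have "exch E F1 F2 k t (t - {u})"
          using ut by (auto simp: exch_def)
        then have "C (t - {u})" using closed t by blast
        then show False using u by (auto simp: U_def)
      qed
    next
      show "card (E - s2) = card E - k" using card_compl s by simp
    qed (rule step2)
    then show ?thesis using walk_iff[OF s(2)] by (simp add: V_def)
  qed
  have blockV: "insert v U \<notin> F1" if v: "v \<in> V" for v
  proof -
    have "insert v {u. \<forall>t. ?R\<^sup>*\<^sup>* s1 t \<longrightarrow> u \<in> t} \<notin> F1"
    proof (rule M1.blocked_by_frozen[where q = "k - 1" and f = "\<lambda>t. t"])
      fix t assume "?R\<^sup>*\<^sup>* s1 t"
      then have t: "C t" using walk_iff s by blast
      then have vt: "v \<in> E - t" using v by (auto simp: V_def)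
      then show "t \<in> F1 \<and> v \<notin> t" using st[OF t] by (auto simp: state_def)
      assume "card t = k - 1"
      then have kt: "Suc (card t) = k" using s by linarith
      show "insert v t \<notin> F1"
      proof
        assume "insert v t \<in> F1"
        then have "exch E F1 F2 k t (insert v t)"
          using vt st[OF t] kt by (auto simp: exch_def exch_up_def state_def)
        then have "C (insert v t)" using closed t by blast
        then show False using v by (auto simp: V_def)
      qed
    next
      show "card s1 = k - 1" using s by simp
    qed (rule step1)
    then show ?thesis using walk_iff[OF s(1)] by (simp add: U_def)
  qed
  have UV: "U \<subseteq> s1" "V \<subseteq> E - s1" using s by (auto simp: U_def V_def)
  then have ind: "U \<in> F1" "V \<in> F2" and sub: "U \<union> V \<subseteq> E"
    using st[OF s(1)] M1.indep_mono[of s1 U] M2.indep_mono[of "E - s1" V] by (auto simp: state_def)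
  \<comment> \<open>No element of \<open>V\<close> extends \<open>U\<close> in \<open>F1\<close> and
    none of \<open>U\<close> extends \<open>V\<close> in \<open>F2\<close>, so both are bases of
    \<open>U \<union> V\<close>.\<close>
  have "card U = rk F1 (U \<union> V)" using blockV ind by (intro M1.maximal_is_basis) auto
  moreover have "card V = rk F2 (U \<union> V)" using blockU ind by (intro M2.maximal_is_basis) auto
  moreover have "card (U \<union> V) = card U + card V"
    using UV M1.finite_indep[OF ind(1)] M2.finite_indep[OF ind(2)] by (intro card_Un_disjoint) auto
  ultimately have "tight (U \<union> V)" using sub by (simp add: tight_def)
  then have "U \<union> V = {}" by (rule no_tight)
  then show False using e_in by (auto simp: U_def)
qed

text \<open>By \<open>room\<close>, the complement of a state of size \<open>k\<close> is smaller
  than the rank of \<open>E - {e}\<close> in \<open>F2\<close>. So a state of size \<open>k\<close>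
  containing \<open>e\<close> can lose some other element, which keeps it from being isolated in the
  minors that fix \<open>e\<close>.\<close>

lemma walk_common_element_if_room:
  assumes IH: "\<And>(S :: 'a set) G1 G2. card S < card E \<Longrightarrow> matroid_pair S G1 G2 \<Longrightarrow> exch_connected S G1 G2"
    and no_tight: "\<And>X. tight X \<Longrightarrow> X = {}"
    and moves: "exch E F1 F2 k A A'" "exch E F1 F2 k B B'"
    and e: "e \<in> A" "e \<in> B"
    and room: "Suc (card E) \<le> k + rk F2 (E - {e})"
  shows "(exch E F1 F2 k)\<^sup>*\<^sup>* A B"
proof -
  have fin: "finite E" by (rule M1.finite_ground)
  \<comment> \<open>The minors that fix \<open>e\<close> in the state: \<open>e\<close> is
    contracted in \<open>F1\<close> and deleted in \<open>F2\<close>.\<close>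
  define S where "S = E - {e}"
  define G1 where "G1 = contraction F1 {e} S"
  define G2 where "G2 = contraction F2 {} S"
  obtain A1 where A1: "(exch E F1 F2 k)\<^sup>*\<^sup>* A A1" "e \<in> A1" "exch_up E F1 F2 k (A1 - {e}) e"
    using reach_movable[OF no_tight moves(1) e(1)] by blast
  obtain B1 where B1: "(exch E F1 F2 k)\<^sup>*\<^sup>* B B1" "e \<in> B1" "exch_up E F1 F2 k (B1 - {e}) e"
    using reach_movable[OF no_tight moves(2) e(2)] by blast
  have ins: "insert e (Z - {e}) = Z" if "e \<in> Z" for Z using that by blast
  have eE: "e \<in> E" using A1(3) by (simp add: exch_up_def)
  have stA: "state A1" "card A1 = k" and stB: "state B1" "card B1 = k"
    using exch_upD(2,5)[OF A1(3)] exch_upD(2,5)[OF B1(3)] ins A1(2) B1(2) by auto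
  have kE: "k \<le> rk F1 E" "k \<le> card E" using exch_state(4,5)[OF moves(1)] .
  have "{e} \<in> F1" using M1.indep_mono[of A1 "{e}"] stA A1(2) by (simp add: state_def)
  then interpret G: matroid_pair S G1 G2
    unfolding G1_def G2_def by (rule contraction_pair) (auto simp: S_def M2.indep_empty)
  have rkG1: "Suc (rk G1 Y) = rk F1 (insert e Y)" if "Y \<subseteq> S" for Y
    using M1.rk_contraction[OF \<open>{e} \<in> F1\<close>, of S Y] that by (simp add: G1_def S_def)
  have rkG2: "rk G2 Y = rk F2 Y" if "Y \<subseteq> S" for Y
    using M2.rk_restriction[of S Y] that by (auto simp: G2_def S_def)
  have Gstate: "G.state (Z - {e})" if "state Z" "e \<in> Z" for Z
  proof -
    have "S - (Z - {e}) = E - Z" using that by (auto simp: S_def)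
    moreover have "Z - {e} \<union> {e} = Z" using that by blast
    ultimately show ?thesis using that unfolding G.state_def
      by (auto simp: state_def G1_def G2_def contraction_def S_def)
  qed
  obtain X where X: "G.tight X" "\<And>Y. G.tight Y \<Longrightarrow> Y \<subseteq> X"
    using G.ex_largest_tight[OF Gstate[OF stA(1) A1(2)]] by blast
  have XS: "X \<subseteq> S" "card X = rk G1 X + rk G2 X" using X(1) by (auto simp: G.tight_def)
  have eX: "e \<notin> X" and finX: "finite X" using XS(1) fin finite_subset by (auto simp: S_def)
  define T where "T = insert e X"
  have TE: "T \<subseteq> E" using XS eE by (auto simp: T_def S_def)
  have cardT: "card T = rk F1 T + rk F2 X"
    using XS rkG1[OF XS(1)] rkG2[OF XS(1)] eX finX by (simp add: T_def)
  \<comment> \<open>\<open>T\<close> misses tightness by exactly one, because \<open>e\<close> is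
    not spanned by \<open>X\<close> in \<open>F2\<close>.\<close>
  have "\<not> tight T" using no_tight[of T] by (auto simp: T_def)
  then have "card T < rk F1 T + rk F2 T" using not_tight_less[OF stA(1) TE] by blast
  then have rk2T: "rk F2 T = Suc (rk F2 X)"
    using cardT M2.rk_insert_le[of e X] by (simp add: T_def)
  \<comment> \<open>Otherwise \<open>card E = rk F1 E + rk F2 (E - {e})\<close>, which contradicts
    \<open>room\<close> because \<open>k \<le> rk F1 E\<close>.\<close>
  have "T \<noteq> E"
  proof
    assume "T = E"
    then have "X = E - {e}" using eX by (auto simp: T_def)
    then show False using room kE cardT \<open>T = E\<close> by simp
  qed
  then have "T \<subset> E" using TE by blast
  then have cT: "card T < card E" using fin by (rule psubset_card_mono[rotated])
  \<comment> \<open>Both intersections have full rank size. At a state where \<open>e\<close> is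
    movable, \<open>insert e (E - Z)\<close> is also independent in \<open>F2\<close>, so there they
    are bases of \<open>T\<close>, sharing only \<open>e\<close>.\<close>
  have spans: "card (Z \<inter> T) = rk F1 T" "card (insert e (E - Z) \<inter> T) = rk F2 T"
    if "state Z" "e \<in> Z" for Z
  proof -
    have G: "card ((Z - {e}) \<inter> X) = rk G1 X" "card (X - (Z - {e})) = rk G2 X"
      using G.tight_iff[OF Gstate[OF that] XS(1)] X(1) by auto
    have "Z \<inter> T = insert e ((Z - {e}) \<inter> X)" using that by (auto simp: T_def)
    moreover have "e \<notin> (Z - {e}) \<inter> X" "finite ((Z - {e}) \<inter> X)" using finX by auto
    ultimately show "card (Z \<inter> T) = rk F1 T" using G(1) rkG1[OF XS(1)] by (simp add: T_def)
    have "insert e (E - Z) \<inter> T = insert e (X - (Z - {e}))" using TE eX by (auto simp: T_def)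
    then show "card (insert e (E - Z) \<inter> T) = rk F2 T"
      using G(2) rkG2[OF XS(1)] finX eX rk2T by simp
  qed
  define H1 where "H1 = contraction F1 {} T"
  define H2 where "H2 = contraction F2 {} T"
  define j where "j = rk F1 T"
  have up_T: "exch_up T H1 H2 j (Z \<inter> T - {e}) e"
    if Z: "exch_up E F1 F2 k (Z - {e}) e" "e \<in> Z" "state Z" for Z
  proof -
    have eT: "e \<in> T" by (simp add: T_def)
    have "E - (Z - {e}) = insert e (E - Z)" using eE by blast
    then have "Z \<in> F1" "insert e (E - Z) \<in> F2"
      using Z(1) ins[OF Z(2)] by (simp_all add: exch_up_def)
    then have "Z \<inter> T \<in> F1" "insert e (E - Z) \<inter> T \<in> F2"
      using M1.indep_mono[of Z "Z \<inter> T"] M2.indep_mono[of "insert e (E - Z)" "insert e (E - Z) \<inter> T"]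
      by auto
    moreover have "insert e (Z \<inter> T - {e}) = Z \<inter> T" using Z(2) eT by blast
    moreover have "T - (Z \<inter> T - {e}) = insert e (E - Z) \<inter> T" using TE eT by blast
    moreover have "Suc (card (Z \<inter> T - {e})) = j"
      using card_Suc_Diff1[of "Z \<inter> T" e] spans(1)[OF Z(3,2)] Z(2) eT finX by (simp add: j_def T_def)
    ultimately show ?thesis using eT by (auto simp: exch_up_def H1_def H2_def contraction_empty)
  qed
  have insT: "insert e (Z \<inter> T - {e}) = Z \<inter> T" if "e \<in> Z" for Z
    using that by (auto simp: T_def)
  have A1T: "exch T H1 H2 j (A1 \<inter> T) (A1 \<inter> T - {e})" and B1T: "exch T H1 H2 j (B1 \<inter> T) (B1 \<inter> T - {e})"
    using up_T[OF A1(3,2) stA(1)] up_T[OF B1(3,2) stB(1)] insT[OF A1(2)] insT[OF B1(2)]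
    unfolding exch_def by metis+
  have "exch_connected T H1 H2"
    unfolding H1_def H2_def using cT TE
    by (intro IH contraction_pair) (auto simp: M1.indep_empty M2.indep_empty)
  \<comment> \<open>A tight set of the restrictions is tight in \<open>E\<close>, hence empty, so
    nothing obstructs a walk inside \<open>T\<close>.\<close>
  moreover have "A1 \<inter> T \<inter> Y = B1 \<inter> T \<inter> Y" if Y: "Y \<subseteq> T" "card Y = rk H1 Y + rk H2 Y" for Y
  proof -
    have "tight Y" using Y TE M1.rk_restriction[OF TE Y(1)] M2.rk_restriction[OF TE Y(1)]
      by (auto simp: tight_def H1_def H2_def)
    then show ?thesis using no_tight by auto
  qed
  ultimately have walkT: "(exch T H1 H2 j)\<^sup>*\<^sup>* (A1 \<inter> T) (B1 \<inter> T)"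
    using A1T B1T unfolding exch_connected_def by blast
  \<comment> \<open>By \<open>basis_replace\<close>, moves inside \<open>T\<close> are compatible
    with the part of \<open>A1\<close> outside \<open>T\<close>.\<close>
  have lift: "exch_up E F1 F2 k (Z \<union> (A1 - T)) x" if up: "exch_up T H1 H2 j Z x" for Z x
  proof -
    have Z: "Z \<subseteq> T" "x \<in> T" "x \<notin> Z" "Suc (card Z) = j" "insert x Z \<in> F1" "T - Z \<in> F2"
      using up by (auto simp: exch_up_def H1_def H2_def contraction_empty)
    have F1: "insert x Z \<union> (A1 - T) \<in> F1"
      using Z stA spans(1)[OF stA(1) A1(2)] by (intro M1.basis_replace) (auto simp: state_def)
    have "E - (A1 - {e}) = insert e (E - A1)" using eE by blast
    then have "insert e (E - A1) \<in> F2" using A1(3) by (simp add: exch_up_def)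
    then have F2: "(T - Z) \<union> (insert e (E - A1) - T) \<in> F2"
      using Z spans(2)[OF stA(1) A1(2)] by (intro M2.basis_replace) auto
    have "E - (Z \<union> (A1 - T)) = (T - Z) \<union> (insert e (E - A1) - T)"
      using TE Z by (auto simp: T_def)
    moreover have "card (Z \<union> (A1 - T)) = card Z + card (A1 - T)"
      using Z TE fin stA by (intro card_Un_disjoint) (auto simp: state_def intro: finite_subset)
    moreover have "card A1 = card (A1 \<inter> T) + card (A1 - T)"
      using stA(1) M1.finite_indep by (intro card_Int_Diff) (simp add: state_def)
    moreover have "A1 \<subseteq> E" using stA by (simp add: state_def)
    ultimately show ?thesis
      using F1 F2 Z TE stA(2) spans(1)[OF stA(1) A1(2)] by (auto simp: exch_up_def j_def)
  qed
  \<comment> \<open>This state removes the obstruction: it already matches the target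
    \<open>B1\<close> on \<open>T\<close>, which contains all tight sets of the minors.\<close>
  define A2 where "A2 = (B1 \<inter> T) \<union> (A1 - T)"
  have walk12: "(exch E F1 F2 k)\<^sup>*\<^sup>* A1 A2"
    using exch_walk_lift[OF lift walkT] by (simp add: A2_def Int_Diff_Un)
  have "insert e ((B1 \<inter> T - {e}) \<union> (A1 - T)) = A2"
    using insT[OF B1(2)] by (auto simp: A2_def)
  then have A2: "state A2" "card A2 = k" "e \<in> A2"
    using exch_upD(2,5)[OF lift[OF up_T[OF B1(3,2) stB(1)]]] by auto
  have exit: "\<exists>x. x \<noteq> e \<and> exch E F1 F2 k Z (Z - {x})" if Z: "state Z" "card Z = k" "e \<in> Z" for Z
  proof -
    have ZE: "Z \<subseteq> E" "E - Z \<in> F2" using Z by (auto simp: state_def)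
    then have "card (E - Z) = card E - k" using Z fin by (simp add: card_Diff_subset finite_subset)
    then have "card (E - Z) < rk F2 (E - {e})" using room kE by linarith
    then obtain x where x: "x \<in> E - {e} - (E - Z)" "insert x (E - Z) \<in> F2"
      using M2.augment_in[OF ZE(2)] by blast
    then have "exch_up E F1 F2 k (Z - {x}) x" using Z by (intro exch_up_remove) auto
    moreover have "Z = insert x (Z - {x})" using x by blast
    ultimately show ?thesis using x unfolding exch_def by blast
  qed
  obtain x y where xy: "x \<noteq> e" "exch E F1 F2 k A2 (A2 - {x})" "y \<noteq> e" "exch E F1 F2 k B1 (B1 - {y})"
    using exit[OF A2] exit[OF stB B1(2)] by blast
  have "(exch E F1 F2 k)\<^sup>*\<^sup>* A2 B1"
  proof (rule walk_by_contraction[OF _ _ _ _ _ xy(2,4)])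
    show "E = S \<union> {e} \<union> {}" using eE by (auto simp: S_def)
    have "card S < card E" using fin eE unfolding S_def by (rule card_Diff1_less)
    then have "exch_connected S G1 G2" using IH G.matroid_pair_axioms by blast
    then show "exch_connected S (contraction F1 {e} S) (contraction F2 {} S)"
      by (simp add: G1_def G2_def)
    fix Y assume "Y \<subseteq> S" "card Y = rk (contraction F1 {e} S) Y + rk (contraction F2 {} S) Y"
    then have "G.tight Y" unfolding G.tight_def by (simp add: G1_def G2_def)
    then have "Y \<subseteq> T" using X(2) by (auto simp: T_def)
    then show "A2 \<inter> Y = B1 \<inter> Y" by (auto simp: A2_def)
  qed (use xy A2(3) B1(2) in \<open>auto simp: S_def\<close>)
  then show ?thesis
    using A1(1) walk12 exch_walk_sym[OF B1(1)] by (meson rtranclp_trans)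
qed

text \<open>If \<open>e\<close> is the only movable element of both states, it is moved in both of them first.\<close>

lemma walk_common_element:
  assumes IH: "\<And>(S :: 'a set) G1 G2. card S < card E \<Longrightarrow> matroid_pair S G1 G2 \<Longrightarrow> exch_connected S G1 G2"
    and no_tight: "\<And>X. tight X \<Longrightarrow> X = {}"
    and moves: "exch E F1 F2 k A A'" "exch E F1 F2 k B B'"
    and e: "e \<in> A" "e \<in> B"
  shows "(exch E F1 F2 k)\<^sup>*\<^sup>* A B"
proof (cases "Suc (card E) \<le> k + rk F2 (E - {e})")
  case True
  then show ?thesis using walk_common_element_if_room[OF IH no_tight moves e] by blast
next
  case False
  have fin: "finite E" by (rule M1.finite_ground)
  have "k \<le> card E" using exch_state(5)[OF moves(1)] .
  then obtain l where l: "k + l = Suc (card E)" using le_Suc_ex le_SucI by metis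
  then have rk2: "rk F2 (E - {e}) < l" using False by linarith
  \<comment> \<open>Without room, a smaller state containing \<open>e\<close> would have a
    complement of \<open>l\<close> elements in \<open>E - {e}\<close>, too many for
    \<open>F2\<close>. So dropping \<open>e\<close> is the only move at a state containing
    it.\<close>
  have only: "exch_up E F1 F2 k (Z - {e}) e \<and> Z' = Z - {e}"
    if "exch E F1 F2 k Z Z'" "e \<in> Z" for Z Z'
  proof -
    have max: "e \<notin> W" if "state W" "Suc (card W) = k" for W
    proof
      assume "e \<in> W"
      have W: "W \<subseteq> E" "E - W \<in> F2" using that by (auto simp: state_def)
      have "card (E - W) = l"
        using card_Diff_subset[of W E] W(1) fin that(2) l by (simp add: finite_subset)
      moreover have "card (E - W) \<le> rk F2 (E - {e})"
        using \<open>e \<in> W\<close> by (intro M2.card_le_rk[OF W(2)]) blast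
      ultimately show False using rk2 by simp
    qed
    from that(1) consider x where "exch_up E F1 F2 k Z x" | x where "exch_up E F1 F2 k Z' x" "Z = insert x Z'"
      unfolding exch_def by blast
    then show ?thesis
    proof cases
      case 1
      then show ?thesis using max[of Z] exch_upD[OF 1] that(2) by blast
    next
      case 2
      then have "e \<notin> Z'" using max[of Z'] exch_upD[OF 2(1)] by blast
      then have "x = e" "Z' = Z - {e}" using 2 that(2) by auto
      then show ?thesis using 2 by simp
    qed
  qed
  have A: "exch_up E F1 F2 k (A - {e}) e" "A' = A - {e}"
    and B: "exch_up E F1 F2 k (B - {e}) e" "B' = B - {e}"
    using only[OF moves(1) e(1)] only[OF moves(2) e(2)] by auto
  have eE: "e \<in> E" using A by (simp add: exch_up_def)
  interpret W: matroid_pair E F2 F1 by (rule swap)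
  \<comment> \<open>After \<open>e\<close> is dropped, both complements contain it, and the previous
    lemma can be tried with the matroids interchanged.\<close>
  have "(exch E F2 F1 l)\<^sup>*\<^sup>* (E - A') (E - B')"
  proof (cases "Suc (card E) \<le> l + rk F1 (E - {e})")
    case True
    have "X = {}" if "W.tight X" for X
      using that no_tight[of X] by (simp add: W.tight_def tight_def add.commute)
    then show ?thesis
      using W.walk_common_element_if_room[OF IH _ exch_complement[OF fin l exch_sym[OF moves(1)]]
          exch_complement[OF fin l exch_sym[OF moves(2)]] _ _ True] A B eE by blast
  next
    case False
    have "state A" using exch_state(1)[OF moves(1)] .
    \<comment> \<open>With room on neither side the two ranks add up to at most
      \<open>card E - 1\<close>, so \<open>E - {e}\<close> is tight and \<open>E\<close> consists of
      \<open>e\<close> alone.\<close>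
    moreover have "rk F1 (E - {e}) + rk F2 (E - {e}) \<le> card (E - {e})"
      using False rk2 l eE fin by simp
    ultimately have "tight (E - {e})" using not_tight_less[of A "E - {e}"] by force
    then have "E \<subseteq> {e}" using no_tight by blast
    then have "A' = {}" "B' = {}" using A B exch_state(1)[OF moves(1)] exch_state(1)[OF moves(2)]
      by (auto simp: state_def)
    then show ?thesis by simp
  qed
  moreover have "E - (E - A') = A'" "E - (E - B') = B'"
    using exch_state(2)[OF moves(1)] exch_state(2)[OF moves(2)] by (auto simp: state_def)
  ultimately have "(exch E F1 F2 k)\<^sup>*\<^sup>* A' B'"
    using exch_walk_complement[OF fin, of l k F2 F1 "E - A'" "E - B'"] l by (simp add: add.commute)
  then show ?thesis using moves exch_sym
    by (meson converse_rtranclp_into_rtranclp rtranclp.rtrancl_into_rtrancl)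
qed

text \<open>Exactly one of \<open>A\<close> and \<open>A'\<close> agrees with \<open>B\<close> about
  the element moved between them. Agreement on an element inside is handled by
  \<open>walk_common_element\<close>, on one outside by passing to complements.\<close>

lemma walk_without_tight:
  assumes IH: "\<And>(S :: 'a set) G1 G2. card S < card E \<Longrightarrow> matroid_pair S G1 G2 \<Longrightarrow> exch_connected S G1 G2"
    and no_tight: "\<And>X. tight X \<Longrightarrow> X = {}"
    and moves: "exch E F1 F2 k A A'" "exch E F1 F2 k B B'"
  shows "(exch E F1 F2 k)\<^sup>*\<^sup>* A B"
proof -
  have fin: "finite E" by (rule M1.finite_ground)
  have sub: "A \<subseteq> E" "B \<subseteq> E" "A' \<subseteq> E" "k \<le> card E"
    using exch_state(1,2,5)[OF moves(1)] exch_state(1)[OF moves(2)] by (auto simp: state_def)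
  have agree: "(exch E F1 F2 k)\<^sup>*\<^sup>* C B"
    if "exch E F1 F2 k C C'" "C \<subseteq> E" "e \<in> E" "e \<in> C \<longleftrightarrow> e \<in> B" for C C' e
  proof (cases "e \<in> C")
    case True
    then show ?thesis using walk_common_element[OF IH no_tight that(1) moves(2)] that by blast
  next
    case False
    interpret W: matroid_pair E F2 F1 by (rule swap)
    obtain l where l: "k + l = Suc (card E)" using le_Suc_ex le_SucI sub(4) by metis
    have "X = {}" if "W.tight X" for X
      using that no_tight[of X] by (simp add: W.tight_def tight_def add.commute)
    then have "(exch E F2 F1 l)\<^sup>*\<^sup>* (E - C) (E - B)"
      using W.walk_common_element[OF IH _ exch_complement[OF fin l that(1)]
          exch_complement[OF fin l moves(2)]] False that by blast
    moreover have "E - (E - C) = C" "E - (E - B) = B" using that sub by auto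
    ultimately show ?thesis
      using exch_walk_complement[OF fin, of l k F2 F1 "E - C" "E - B"] l by (simp add: add.commute)
  qed
  obtain x where x: "x \<in> E" "x \<in> A \<longleftrightarrow> x \<notin> A'"
    using moves(1) unfolding exch_def exch_up_def by blast
  show ?thesis
  proof (cases "x \<in> A \<longleftrightarrow> x \<in> B")
    case True
    then show ?thesis using agree[OF moves(1) sub(1) x(1)] by blast
  next
    case False
    then have "(exch E F1 F2 k)\<^sup>*\<^sup>* A' B" using agree[OF exch_sym[OF moves(1)] sub(3) x(1)] x by blast
    then show ?thesis using moves(1) by (rule converse_rtranclp_into_rtranclp[rotated])
  qed
qed

text \<open>All four states cut \<open>X\<close> into the same bases \<open>K1\<close> and
  \<open>K2\<close>, which are contracted. If \<open>Y\<close> is tight in the minors then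
  \<open>Y \<union> X\<close> is tight, so the assumed agreement carries over.\<close>

lemma walk_with_tight:
  assumes IH: "\<And>(S :: 'a set) G1 G2. card S < card E \<Longrightarrow> matroid_pair S G1 G2 \<Longrightarrow> exch_connected S G1 G2"
    and X: "tight X" "X \<noteq> {}"
    and moves: "exch E F1 F2 k A A'" "exch E F1 F2 k B B'"
    and agree: "\<And>Y. tight Y \<Longrightarrow> A \<inter> Y = B \<inter> Y"
  shows "(exch E F1 F2 k)\<^sup>*\<^sup>* A B"
proof -
  have fin: "finite E" by (rule M1.finite_ground)
  have XE: "X \<subseteq> E" using X by (simp add: tight_def)
  define K1 where "K1 = A \<inter> X"
  define K2 where "K2 = X - A"
  have eqs: "A' \<inter> X = K1" "B \<inter> X = K1" "B' \<inter> X = K1"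
    using exch_tight[OF moves(1) X(1)] exch_tight[OF moves(2) X(1)] agree[OF X(1)] by (auto simp: K1_def)
  have stA: "state A" using exch_state(1)[OF moves(1)] .
  have rkK: "card K1 = rk F1 X" "card K2 = rk F2 X"
    using tight_iff[OF stA XE] X by (auto simp: K1_def K2_def)
  have K: "K1 \<in> F1" "K2 \<in> F2" "K1 \<subseteq> X" "K2 \<subseteq> X"
    using stA M1.indep_mono[of A K1] M2.indep_mono[of "E - A" K2] XE by (auto simp: state_def K1_def K2_def)
  define S where "S = E - X"
  have S: "S \<subseteq> E" "S \<inter> K1 = {}" "S \<inter> K2 = {}" using K by (auto simp: S_def)
  show ?thesis
  proof (rule walk_by_contraction[OF _ S(2,3) _ _ moves])
    show "E = S \<union> K1 \<union> K2" using XE by (auto simp: S_def K1_def K2_def)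
    have "S \<subset> E" using X(2) XE by (auto simp: S_def)
    then have "card S < card E" using fin by (rule psubset_card_mono[rotated])
    then show "exch_connected S (contraction F1 K1 S) (contraction F2 K2 S)"
      using contraction_pair[OF K(1,2) S] IH by blast
    fix Y assume Y: "Y \<subseteq> S" "card Y = rk (contraction F1 K1 S) Y + rk (contraction F2 K2 S) Y"
    have "card (Y \<union> X) = card Y + card X"
      using Y(1) XE fin by (intro card_Un_disjoint) (auto simp: S_def intro: finite_subset)
    also have "\<dots> = rk F1 (Y \<union> X) + rk F2 (Y \<union> X)"
      using M1.rk_contraction[OF K(1) S(1,2) Y(1)] M2.rk_contraction[OF K(2) S(1,3) Y(1)]
        M1.rk_Un_basis[OF K(1,3) rkK(1), of Y] M2.rk_Un_basis[OF K(2,4) rkK(2), of Y] Y(2) X(1) rkK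
      by (simp add: tight_def)
    finally have "tight (Y \<union> X)" using Y XE S by (simp add: tight_def)
    then show "A \<inter> Y = B \<inter> Y" using agree by blast
  qed (use eqs in \<open>auto simp: K1_def K2_def\<close>)
qed

end

lemma exch_connected:
  assumes "matroid_pair E F1 F2"
  shows "exch_connected E F1 F2"
  using assms
proof (induction "card E" arbitrary: E F1 F2 rule: less_induct)
  case less
  interpret matroid_pair E F1 F2 by (rule less.prems)
  show ?case unfolding exch_connected_def
  proof (intro allI impI)
    fix k A A' B B'
    assume moves: "exch E F1 F2 k A A'" "exch E F1 F2 k B B'"
      and "\<forall>X \<subseteq> E. card X = rk F1 X + rk F2 X \<longrightarrow> A \<inter> X = B \<inter> X"
    then have agree: "A \<inter> X = B \<inter> X" if "tight X" for X using that by (auto simp: tight_def)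
    show "(exch E F1 F2 k)\<^sup>*\<^sup>* A B"
      using walk_with_tight[OF less.hyps _ _ moves agree] walk_without_tight[OF less.hyps _ moves]
      by blast
  qed
qed

section \<open>The exchange graph\<close>

context matroid
begin

lemma cl_basis:
  assumes "B \<in> \<I>" "B \<subseteq> Y" "Y \<subseteq> E" "card B = rk \<I> Y"
  shows "cl E \<I> B = cl E \<I> Y"
proof
  show "cl E \<I> B \<subseteq> cl E \<I> Y" using assms by (intro cl_mono)
  have "Y \<subseteq> cl E \<I> B"
  proof
    fix y assume "y \<in> Y"
    have "card B \<le> rk \<I> B" using card_le_rk[OF assms(1) order.refl] .
    moreover have "rk \<I> B \<le> rk \<I> (B \<union> {y})" "rk \<I> (B \<union> {y}) \<le> rk \<I> Y"
      using assms \<open>y \<in> Y\<close> by (intro rk_mono; auto)+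
    ultimately show "y \<in> cl E \<I> B" using assms \<open>y \<in> Y\<close> by (auto simp: cl_def)
  qed
  then show "cl E \<I> Y \<subseteq> cl E \<I> B" using assms by (intro cl_least) auto
qed

lemma indep_notin_cl:
  assumes "insert i U \<in> \<I>" "i \<notin> U"
  shows "i \<notin> cl E \<I> U"
proof
  assume "i \<in> cl E \<I> U"
  then have "rk \<I> (insert i U) = rk \<I> U" by (simp add: cl_def)
  moreover have "card (insert i U) \<le> rk \<I> (insert i U)" using card_le_rk[OF assms(1)] by blast
  moreover have U: "U \<in> \<I>" using indep_mono[OF assms(1)] by blast
  moreover have "card U = rk \<I> U" using U by (intro maximal_is_basis) auto
  ultimately show False using assms(2) finite_indep[OF U] by simp
qed

lemma MCP_codependent:
  assumes "I \<in> \<I>" "J \<in> \<I>"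
  shows "codependent E \<I> (I, J) (MCP E \<I> (I, J))"
  using theI'[OF ex1_maximal_codependent[OF assms]] by (simp add: MCP_def maximal_codependent_def)

text \<open>The union with the maximal pair is again codependent, so the maximal pair is the
  greatest one.\<close>

lemma codependent_le_MCP:
  assumes IJ: "I \<in> \<I>" "J \<in> \<I>" and UV: "codependent E \<I> (I, J) (U, V)"
  shows "U \<subseteq> fst (MCP E \<I> (I, J))" "V \<subseteq> snd (MCP E \<I> (I, J))"
proof -
  obtain U' V' where M: "MCP E \<I> (I, J) = (U', V')" by fastforce
  have max: "maximal_codependent E \<I> (I, J) (U', V')"
    using theI'[OF ex1_maximal_codependent[OF IJ]] M by (simp add: MCP_def)
  then have "codependent E \<I> (I, J) (U \<union> U', V \<union> V')"
    using codependent_union[OF _ _ UV] IJ indep_subset_ground by (simp add: maximal_codependent_def)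
  then have "(U \<union> U', V \<union> V') = (U', V')"
    using max unfolding maximal_codependent_def pair_subset_def by blast
  then show "U \<subseteq> fst (MCP E \<I> (I, J))" "V \<subseteq> snd (MCP E \<I> (I, J))" using M by auto
qed

text \<open>The moved element belongs to no codependent pair. If \<open>U \<subseteq> I\<close>,
  then \<open>insert i U\<close> is independent, so \<open>i\<close> is outside the closure of
  \<open>U\<close>, which contains \<open>V\<close>. The other direction is symmetric.\<close>

lemma codependent_move:
  assumes I: "insert i I \<in> \<I>" "i \<notin> I" and J: "J \<in> \<I>" "i \<in> J"
  shows "codependent E \<I> (I, J) = codependent E \<I> (insert i I, J - {i})"
proof (rule ext, rule iffI; clarify)
  have sub: "insert i I \<subseteq> E" "J \<subseteq> E" using indep_subset_ground I J by auto
  fix U V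
  show "codependent E \<I> (insert i I, J - {i}) (U, V)" if c: "codependent E \<I> (I, J) (U, V)"
  proof -
    have UV: "U \<subseteq> I" "V \<subseteq> J" "cl E \<I> U = cl E \<I> V" using c by (auto simp: codependent_def)
    have "insert i U \<in> \<I>" using indep_mono[OF I(1)] UV by blast
    then have "i \<notin> cl E \<I> U" using indep_notin_cl[of i U] UV I by blast
    then have "i \<notin> V" using cl_extensive[of V] UV sub by blast
    then show ?thesis using UV by (auto simp: codependent_def)
  qed
  show "codependent E \<I> (I, J) (U, V)" if c: "codependent E \<I> (insert i I, J - {i}) (U, V)"
  proof -
    have UV: "U \<subseteq> insert i I" "V \<subseteq> J - {i}" "cl E \<I> U = cl E \<I> V" using c by (auto simp: codependent_def)
    have "insert i V \<in> \<I>" using indep_mono[OF J(1)] UV J by blast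
    then have "i \<notin> cl E \<I> V" using indep_notin_cl[of i V] UV by blast
    then have "i \<notin> U" using cl_extensive[of U] UV sub by blast
    then show ?thesis using UV by (auto simp: codependent_def)
  qed
qed

definition pair_invariant :: "'a set \<times> 'a set \<Rightarrow> 'a multiset \<times> ('a set \<times> 'a set)" where
  "pair_invariant P = (mset_set (fst P) + mset_set (snd P), MCP E \<I> P)"

lemma pair_invariant_move:
  assumes "insert i I \<in> \<I>" "i \<notin> I" "J \<in> \<I>" "i \<in> J"
  shows "pair_invariant (I, J) = pair_invariant (insert i I, J - {i})"
proof -
  have "finite I" "finite J" using finite_indep[OF assms(1)] finite_indep[OF assms(3)] by auto
  then have "mset_set I + mset_set J = mset_set (insert i I) + mset_set (J - {i})"
    using assms by (simp add: mset_set.remove[of J i])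
  moreover have "MCP E \<I> (I, J) = MCP E \<I> (insert i I, J - {i})"
    using codependent_move[OF assms] by (simp add: MCP_def maximal_codependent_def)
  ultimately show ?thesis by (simp add: pair_invariant_def)
qed

section \<open>Edges, components and the translation into complementary states\<close>

abbreviation "XG p q \<equiv> exchange_subgraph E \<I> p q"

lemma verts_XG: "(I, J) \<in> verts (XG p q) \<longleftrightarrow>
    I \<in> \<I> \<and> J \<in> \<I> \<and> (card I = p \<and> card J = q \<or> card I = p - 1 \<and> card J = q + 1)"
  by (auto simp: exchange_subgraph_def indep_of_size_def)

lemma dominates_XG: "P \<rightarrow>\<^bsub>XG p q\<^esub> Q \<longleftrightarrow> P \<in> verts (XG p q) \<and> Q \<in> verts (XG p q) \<and> exchange_adjacent E P Q"
  by (auto simp: exchange_subgraph_def exchange_graph_def arcs_ends_def arc_to_ends_def indep_of_size_def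
      image_iff)

lemma edge_cases:
  assumes "(I, J) \<rightarrow>\<^bsub>XG p q\<^esub> (I', J')"
  obtains (up) i where "i \<notin> I" "i \<in> J" "I' = insert i I" "J' = J - {i}"
  | (down) i where "i \<notin> I'" "i \<in> J'" "I = insert i I'" "J = J' - {i}"
proof -
  obtain i where "(i \<notin> I \<and> I' = I \<union> {i} \<and> i \<in> J \<and> J' = J - {i}) \<or>
      (i \<in> I \<and> I' = I - {i} \<and> i \<notin> J \<and> J' = J \<union> {i})"
    using assms unfolding dominates_XG exchange_adjacent_def by blast
  then show ?thesis
  proof (elim disjE conjE)
    assume "i \<notin> I" "I' = I \<union> {i}" "i \<in> J" "J' = J - {i}"
    then show ?thesis using up[of i] by simp
  next
    assume "i \<in> I" "I' = I - {i}" "i \<notin> J" "J' = J \<union> {i}"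
    moreover from this have "I = insert i I'" "J = J' - {i}" by auto
    ultimately show ?thesis using down[of i] by blast
  qed
qed

lemma edge_indep:
  assumes "(I, J) \<rightarrow>\<^bsub>XG p q\<^esub> (I', J')"
  shows "I \<in> \<I>" "J \<in> \<I>" "I' \<in> \<I>" "J' \<in> \<I>"
  using assms by (auto simp: dominates_XG verts_XG)

lemma edge_invariant:
  assumes "P \<rightarrow>\<^bsub>XG p q\<^esub> Q"
  shows "pair_invariant P = pair_invariant Q"
proof -
  obtain I J I' J' where eq: "P = (I, J)" "Q = (I', J')" by fastforce
  note edge = assms[unfolded eq]
  from edge show ?thesis unfolding eq
    by (cases rule: edge_cases) (use edge_indep[OF edge] pair_invariant_move in metis)+
qed

lemma same_component_iff:
  assumes "P \<in> verts (XG p q)"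
  shows "same_component (XG p q) P Q \<longleftrightarrow> P \<rightarrow>\<^sup>*\<^bsub>XG p q\<^esub> Q"
proof -
  interpret graph "XG p q" by (rule graph_exchange_subgraph)
  show ?thesis
  proof
    assume "same_component (XG p q) P Q"
    then show "P \<rightarrow>\<^sup>*\<^bsub>XG p q\<^esub> Q" unfolding same_component_def by (auto simp: in_sccs_verts_conv_reachable)
  next
    assume r: "P \<rightarrow>\<^sup>*\<^bsub>XG p q\<^esub> Q"
    have "P \<in> scc_of P" "Q \<in> scc_of P"
      using r assms symmetric_reachable[OF sym_arcs r] by (auto simp: scc_of_def)
    then show "same_component (XG p q) P Q"
      unfolding same_component_def using scc_of_in_sccs_verts[OF assms] by blast
  qed
qed

lemma reachable_invariant:
  assumes "P \<rightarrow>\<^sup>*\<^bsub>XG p q\<^esub> Q"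
  shows "pair_invariant P = pair_invariant Q"
proof -
  interpret graph "XG p q" by (rule graph_exchange_subgraph)
  show ?thesis using assms by (induction rule: reachable_induct) (auto dest: edge_invariant)
qed

text \<open>The common part \<open>D\<close> is unchanged by the move and is contracted. On the
  symmetric difference \<open>S\<close> the pair becomes the complementary sets \<open>I - D\<close>
  and \<open>J - D\<close>, in two copies of one matroid.\<close>

lemma exch_of_move:
  assumes I: "insert i I \<in> \<I>" "i \<notin> I" and J: "J \<in> \<I>" "i \<in> J"
    and DS: "D = I \<inter> J" "S = (I \<union> J) - D" and k: "k + card D = card (insert i I)"
    and F: "F = contraction \<I> D S"
  shows "exch S F F k (I - D) (insert i I - D)"
proof -
  have finI: "finite I" using finite_indep[OF I(1)] by simp
  have "I - D = I - J" using DS by blast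
  then have "card I = card D + card (I - D)" using card_Int_Diff[OF finI, of J] DS by simp
  then have "Suc (card (I - D)) = k" using k I finI by simp
  moreover have "insert i (I - D) = insert i I - D" using I DS by auto
  moreover have "insert i I - D \<union> D = insert i I" "S - (I - D) \<union> D = J" using DS by auto
  ultimately have "exch_up S F F k (I - D) i"
    using I J DS by (auto simp: exch_up_def F contraction_def insert_Diff_if)
  then show ?thesis using \<open>insert i (I - D) = insert i I - D\<close> by (auto simp: exch_def)
qed

lemma exch_of_edge:
  assumes edge: "(I, J) \<rightarrow>\<^bsub>XG p q\<^esub> (I', J')" and p: "1 \<le> p"
    and DS: "D = I \<inter> J" "S = (I \<union> J) - D" and k: "k + card D = p"
    and F: "F = contraction \<I> D S"
  shows "exch S F F k (I - D) (I' - D)"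
  using edge
proof (cases rule: edge_cases)
  case (up i)
  have "card (insert i I) = p"
  proof -
    have "card I = p \<or> card I = p - 1" "card I' = p \<or> card I' = p - 1"
      using edge by (auto simp: dominates_XG verts_XG)
    then show ?thesis using up p finite_indep[OF edge_indep(1)[OF edge]] by auto
  qed
  then show ?thesis
    using exch_of_move[of i I J D S k F] up edge_indep[OF edge] DS k F by auto
next
  case (down i)
  have "card (insert i I') = p"
  proof -
    have "card I = p \<or> card I = p - 1" "card I' = p \<or> card I' = p - 1"
      using edge by (auto simp: dominates_XG verts_XG)
    then show ?thesis using down p finite_indep[OF edge_indep(3)[OF edge]] by auto
  qed
  moreover have "D = I' \<inter> J'" "S = (I' \<union> J') - D" using DS down by auto
  ultimately show ?thesis
    using exch_of_move[of i I' J' D S k F] down edge_indep[OF edge] k F exch_sym by metis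
qed

text \<open>The equation for \<open>q\<close> counts elements with multiplicity. It fixes the size
  of the second component, as \<open>k\<close> does for the first.\<close>

lemma edge_of_exch:
  assumes S: "S \<subseteq> E" "S \<inter> D = {}" and p: "k + card D = p" and q: "card S + 2 * card D = p + q"
    and D: "finite D" and ex: "exch S (contraction \<I> D S) (contraction \<I> D S) k A B"
  shows "(A \<union> D, (S - A) \<union> D) \<rightarrow>\<^bsub>XG p q\<^esub> (B \<union> D, (S - B) \<union> D)"
proof -
  have finS: "finite S" using S finite_ground finite_subset by blast
  have up: "(A \<union> D, (S - A) \<union> D) \<rightarrow>\<^bsub>XG p q\<^esub> (insert x A \<union> D, (S - insert x A) \<union> D)"
    if "exch_up S (contraction \<I> D S) (contraction \<I> D S) k A x" for A x
  proof -
    have A: "A \<subseteq> S" "x \<in> S" "x \<notin> A" "Suc (card A) = k" "insert x A \<union> D \<in> \<I>" "(S - A) \<union> D \<in> \<I>"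
      using that by (auto simp: exch_up_def contraction_def)
    have finA: "finite A" using A finS finite_subset by blast
    have ind: "A \<union> D \<in> \<I>" "(S - insert x A) \<union> D \<in> \<I>"
      by (rule indep_mono[OF A(5)], blast) (rule indep_mono[OF A(6)], blast)
    have disj: "card (Z \<union> D) = card Z + card D" if "Z \<subseteq> S" for Z
      using that S(2) finS D by (intro card_Un_disjoint) (auto intro: finite_subset)
    have cards: "card (A \<union> D) = card A + card D" "card (insert x A \<union> D) = Suc (card A) + card D"
      "card ((S - A) \<union> D) = card (S - A) + card D"
      "card ((S - insert x A) \<union> D) = card (S - insert x A) + card D"
      using disj[of A] disj[of "insert x A"] disj[of "S - A"] disj[of "S - insert x A"] A finA by auto
    have cS: "card (S - A) = card S - card A" "card (S - insert x A) = card S - Suc (card A)"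
      "Suc (card A) \<le> card S"
      using A(1-3) finA card_mono[OF finS, of "insert x A"] card_Diff_subset[of A S]
        card_Diff_subset[of "insert x A" S] by simp_all
    have "x \<in> E" "x \<notin> A \<union> D" "insert x A \<union> D = A \<union> D \<union> {x}" "x \<in> (S - A) \<union> D"
      "(S - insert x A) \<union> D = ((S - A) \<union> D) - {x}"
      using S A by auto
    then have "exchange_adjacent E (A \<union> D, (S - A) \<union> D) (insert x A \<union> D, (S - insert x A) \<union> D)"
      unfolding exchange_adjacent_def by blast
    moreover have "card (A \<union> D) = p - 1" "card ((S - A) \<union> D) = q + 1"
      "card (insert x A \<union> D) = p" "card ((S - insert x A) \<union> D) = q"
      using A(4) cards cS p q by linarith+
    then have "(A \<union> D, (S - A) \<union> D) \<in> verts (XG p q)"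
      "(insert x A \<union> D, (S - insert x A) \<union> D) \<in> verts (XG p q)"
      using A(5,6) ind unfolding verts_XG by blast+
    ultimately show ?thesis by (simp add: dominates_XG)
  qed
  have sym: "P \<rightarrow>\<^bsub>XG p q\<^esub> Q \<Longrightarrow> Q \<rightarrow>\<^bsub>XG p q\<^esub> P" for P Q
    by (auto simp: dominates_XG intro: exchange_adjacent_sym)
  from ex show ?thesis unfolding exch_def by (elim disjE exE conjE) (use up sym in simp_all)
qed

lemma reachable_of_walk:
  assumes S: "S \<subseteq> E" "S \<inter> D = {}" and p: "k + card D = p" and q: "card S + 2 * card D = p + q"
    and D: "finite D" and walk: "(exch S (contraction \<I> D S) (contraction \<I> D S) k)\<^sup>*\<^sup>* A B"
    and A: "(A \<union> D, (S - A) \<union> D) \<in> verts (XG p q)"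
  shows "(A \<union> D, (S - A) \<union> D) \<rightarrow>\<^sup>*\<^bsub>XG p q\<^esub> (B \<union> D, (S - B) \<union> D)"
proof -
  interpret graph "XG p q" by (rule graph_exchange_subgraph)
  show ?thesis using walk
  proof (induction rule: rtranclp_induct)
    case (step B C)
    then show ?case using edge_of_exch[OF S p q D step.hyps(2)] reachable_adj_trans by blast
  qed (use A in simp)
qed

text \<open>Tightness makes \<open>I\<close> and \<open>J\<close> meet \<open>X \<union> D\<close>
  in bases of it, so both intersections have the closure of \<open>X \<union> D\<close>. This links
  tight sets to the MCP.\<close>

lemma tight_codependent:
  assumes IJ: "I \<in> \<I>" "J \<in> \<I>" and DS: "D = I \<inter> J" "S = (I \<union> J) - D"
    and X: "X \<subseteq> S" "card X = rk (contraction \<I> D S) X + rk (contraction \<I> D S) X"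
  shows "codependent E \<I> (I, J) (I \<inter> (X \<union> D), J \<inter> (X \<union> D))"
proof -
  let ?F = "contraction \<I> D S"
  have D: "D \<in> \<I>" and SD: "S \<inter> D = {}" using indep_mono[OF IJ(1)] DS by auto
  have SE: "S \<subseteq> E" "X \<union> D \<subseteq> E" using IJ indep_subset_ground DS X by blast+
  interpret C: matroid_pair S ?F ?F
    using matroid_contraction[OF D SE(1) SD] by (simp add: matroid_pair_def)
  have eq: "I - D \<union> D = I" "S - (I - D) \<union> D = J" using DS by auto
  have "C.state (I - D)" unfolding C.state_def using IJ eq DS by (auto simp: contraction_def)
  then have c: "card ((I - D) \<inter> X) = rk ?F X" "card (X - (I - D)) = rk ?F X"
    using C.tight_iff[of "I - D" X] X by (auto simp: C.tight_def)
  have fin: "finite D" "finite X" using finite_indep[OF D] SE finite_ground finite_subset by blast+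
  have rkX: "rk ?F X + card D = rk \<I> (X \<union> D)" using rk_contraction[OF D SE(1) SD X(1)] .
  have "I \<inter> (X \<union> D) = (I - D) \<inter> X \<union> D" "J \<inter> (X \<union> D) = (X - (I - D)) \<union> D"
    using DS X(1) by auto
  then have "card (I \<inter> (X \<union> D)) = rk \<I> (X \<union> D)" "card (J \<inter> (X \<union> D)) = rk \<I> (X \<union> D)"
    using c rkX fin SD X(1) card_Un_disjoint[of "(I - D) \<inter> X" D] card_Un_disjoint[of "X - (I - D)" D]
    by auto
  moreover have "I \<inter> (X \<union> D) \<in> \<I>" "J \<inter> (X \<union> D) \<in> \<I>"
    using indep_mono[OF IJ(1)] indep_mono[OF IJ(2)] by blast+
  ultimately have "cl E \<I> (I \<inter> (X \<union> D)) = cl E \<I> (X \<union> D)" "cl E \<I> (J \<inter> (X \<union> D)) = cl E \<I> (X \<union> D)"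
    using SE(2) by (intro cl_basis; simp)+
  then show ?thesis by (auto simp: codependent_def)
qed

lemma reachable_if_same_invariant:
  assumes p: "1 \<le> p"
    and edges: "(I, J) \<rightarrow>\<^bsub>XG p q\<^esub> P" "(I', J') \<rightarrow>\<^bsub>XG p q\<^esub> P'"
    and ms: "mset_set I + mset_set J = mset_set I' + mset_set J'"
    and mcp: "MCP E \<I> (I, J) = MCP E \<I> (I', J')"
  shows "(I, J) \<rightarrow>\<^sup>*\<^bsub>XG p q\<^esub> (I', J')"
proof -
  obtain K L K' L' where P: "P = (K, L)" "P' = (K', L')" by fastforce
  note edge = edges(1)[unfolded P] and edge' = edges(2)[unfolded P]
  note ind = edge_indep(1,2)[OF edge] and ind' = edge_indep(1,2)[OF edge']
  have fin: "finite I" "finite J" "finite I'" "finite J'" using ind ind' finite_indep by auto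
  have cnt: "(if x \<in> I then 1 else 0) + (if x \<in> J then 1 else 0 :: nat) =
      (if x \<in> I' then 1 else 0) + (if x \<in> J' then 1 else 0)" for x
    using arg_cong[OF ms, of "\<lambda>M. count M x"] fin by (simp add: count_mset_set')
  define D where "D = I \<inter> J"
  define S where "S = (I \<union> J) - D"
  \<comment> \<open>Multiplicity 2 marks the intersection and positive multiplicity the union, so
    both pairs give the same \<open>D\<close> and \<open>S\<close>.\<close>
  have "x \<in> I \<and> x \<in> J \<longleftrightarrow> x \<in> I' \<and> x \<in> J'" "x \<in> I \<or> x \<in> J \<longleftrightarrow> x \<in> I' \<or> x \<in> J'" for x
    using cnt[of x] by (auto split: if_splits)
  then have D': "D = I' \<inter> J'" and S': "S = (I' \<union> J') - D" unfolding D_def S_def by blast+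
  let ?F = "contraction \<I> D S"
  have Dind: "D \<in> \<I>" and SD: "S \<inter> D = {}" using indep_mono[OF ind(1)] by (auto simp: D_def S_def)
  have SE: "S \<subseteq> E" using ind indep_subset_ground by (auto simp: S_def)
  have sizes: "card I + card J = p + q" "card I \<le> p"
    using edge p by (auto simp: dominates_XG verts_XG)
  have "card D \<le> card I" using fin by (auto simp: D_def intro: card_mono)
  then obtain k where k: "k + card D = p" using sizes by (metis le_add_diff_inverse2 order_trans)
  have "card (I \<union> J) = card S + card D"
  proof -
    have "I \<union> J = S \<union> D" by (auto simp: S_def D_def)
    moreover have "finite S" "finite D" using fin by (auto simp: S_def D_def)
    ultimately show ?thesis using SD by (simp add: card_Un_disjoint)
  qed
  then have q: "card S + 2 * card D = p + q"
    using card_Un_Int[OF fin(1,2)] sizes by (simp add: D_def)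
  have finD: "finite D" using finite_indep[OF Dind] .
  have "exch_connected S ?F ?F"
    using matroid_contraction[OF Dind SE SD] by (intro exch_connected) (simp add: matroid_pair_def)
  moreover note exch_of_edge[OF edge p D_def S_def k refl] exch_of_edge[OF edge' p D' S' k refl]
  moreover have "(I - D) \<inter> X = (I' - D) \<inter> X" if X: "X \<subseteq> S" "card X = rk ?F X + rk ?F X" for X
  proof -
    \<comment> \<open>Each tight set yields a codependent pair, which lies below the common MCP and
      hence in both pairs.\<close>
    have "I \<inter> X \<subseteq> I'" "J \<inter> X \<subseteq> J'" "I' \<inter> X \<subseteq> I" 
      using codependent_le_MCP[OF ind tight_codependent[OF ind D_def S_def X]] MCP_codependent[OF ind]
        codependent_le_MCP[OF ind' tight_codependent[OF ind' D' S' X]] MCP_codependent[OF ind'] mcp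
      by (auto simp: codependent_def split: prod.splits)
    then show ?thesis by blast
  qed
  ultimately have walk: "(exch S ?F ?F k)\<^sup>*\<^sup>* (I - D) (I' - D)"
    unfolding exch_connected_def by blast
  have eq: "I - D \<union> D = I" "S - (I - D) \<union> D = J" unfolding S_def D_def by auto
  have eq': "I' - D \<union> D = I'" "S - (I' - D) \<union> D = J'" unfolding S' unfolding D' by auto
  have "(I, J) \<in> verts (XG p q)" using edge by (simp add: dominates_XG)
  then show ?thesis using reachable_of_walk[OF SE SD k q finD walk] eq eq' by simp
qed

end

theorem theorem4p14:
  fixes E :: "'a set" and \<I> :: "'a set set" and I J I' J' :: "'a set" and r p q :: nat
  assumes "matroid E \<I>" and "r = rk \<I> E"
    and "p \<in> {1..r}" and "q \<in> {0..<r}"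
    and "(I, J) \<in> verts (exchange_subgraph E \<I> p q)"
    and "\<not> isolated_vertex (exchange_subgraph E \<I> p q) (I, J)"
    and "(I', J') \<in> verts (exchange_subgraph E \<I> p q)"
    and "\<not> isolated_vertex (exchange_subgraph E \<I> p q) (I', J')"
  shows "same_component (exchange_subgraph E \<I> p q) (I, J) (I', J') \<longleftrightarrow>
    mset_set I + mset_set J = mset_set I' + mset_set J' \<and>
    MCP E \<I> (I, J) = MCP E \<I> (I', J')"
proof -
  interpret matroid E \<I> by (rule assms(1))
  obtain P P' where edges: "(I, J) \<rightarrow>\<^bsub>XG p q\<^esub> P" "(I', J') \<rightarrow>\<^bsub>XG p q\<^esub> P'"
    using assms(5-8) by (auto simp: isolated_vertex_def)
  have p: "1 \<le> p" using assms(3) by simp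
  show ?thesis
    using same_component_iff[OF assms(5)] reachable_if_same_invariant[OF p edges]
      reachable_invariant[where P = "(I, J)" and Q = "(I', J')"]
    by (auto simp: pair_invariant_def)
qed

end
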